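(* There is a randomized algorithm for Partial Grundy Coloring running in time $2^{\mathcal{O}(k^4)}\cdot n^{\mathcal{O}(1)}$ on an $n$-vertex input graph $G$ and integer $k$, such that if $(G,k)$ is a no-instance the algorithm outputs No with probability $1$, and if $(G,k)$ is a yes-instance it outputs Yes with probability at least $2/3$.
   Context: Partial Grundy Coloring: given a graph $G$ and a positive integer $k$, decide whether $G$ admits a partial Grundy coloring using at least $k$ colors, i.e., for some $k'\ge k$ a proper coloring $c:V(G)\to[k']$ such that for every $i\in[k']$ there is a vertex $v$ with $c(v)=i$ which, for every $j\in[i-1]$, has a neighbor $u$ with $c(u)=j$. *)

theory Defs
  imports "HOL-Probability.Probability_Mass_Function" "Graph_Theory.Pair_Digraph"
begin

section \<open>Partial Grundy colorings\<close>

text \<open>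
  A finite simple undirected graph is a \<^locale>\<open>pair_graph\<close>: every edge is represented by
  both of its orientations. The colors are \<open>1, \<dots>, m\<close>.
\<close>

definition proper_coloring :: "'a pair_pre_digraph \<Rightarrow> nat \<Rightarrow> ('a \<Rightarrow> nat) \<Rightarrow> bool" where
  "proper_coloring G m c \<longleftrightarrow>
     (\<forall>v\<in>pverts G. c v \<in> {1..m}) \<and> (\<forall>(u, v)\<in>parcs G. c u \<noteq> c v)"

definition partial_grundy_coloring :: "'a pair_pre_digraph \<Rightarrow> nat \<Rightarrow> ('a \<Rightarrow> nat) \<Rightarrow> bool" where
  "partial_grundy_coloring G m c \<longleftrightarrow>
     proper_coloring G m c \<and>
     (\<forall>i\<in>{1..m}. \<exists>v\<in>pverts G. c v = i \<and>
        (\<forall>j\<in>{1..<i}. \<exists>u\<in>pverts G. (v, u) \<in> parcs G \<and> c u = j))"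

definition partial_grundy_yes :: "'a pair_pre_digraph \<Rightarrow> nat \<Rightarrow> bool" where
  "partial_grundy_yes G k \<longleftrightarrow> (\<exists>m\<ge>k. \<exists>c. partial_grundy_coloring G m c)"

section \<open>Randomized algorithms\<close>

text \<open>
  The machine model is a probabilistic random access machine, programmed in structured form.
  The state consists of registers and zero-based arrays, all holding natural numbers; a program
  mentions only finitely many registers and arrays. Every command takes unit time. The only
  arithmetic is addition and truncated subtraction, so a number computed within \<open>t\<close> steps exceeds
  the largest number in the program and its input by a factor of at most \<open>2 ^ t\<close>; hence unit-cost
  running times are polynomially related to those of probabilistic Turing machines, and a class of
  time bounds \<open>2\<^bsup>O(k^4)\<^esup> n\<^bsup>O(1)\<^esup>\<close> does not depend on this choice of model.
\<close>

record ram_state =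
  regs :: "nat \<Rightarrow> nat"
  arrs :: "nat \<Rightarrow> nat \<Rightarrow> nat"

datatype com =
    SKIP
  | SET nat nat        \<comment> \<open>\<open>SET r c\<close>: register \<open>r\<close> := constant \<open>c\<close>\<close>
  | COPY nat nat       \<comment> \<open>\<open>COPY r x\<close>: register \<open>r\<close> := register \<open>x\<close>\<close>
  | ADD nat nat nat
  | SUB nat nat nat
  | LOAD nat nat nat   \<comment> \<open>\<open>LOAD r a x\<close>: register \<open>r\<close> := cell of array \<open>a\<close> at the index in register \<open>x\<close>\<close>
  | STORE nat nat nat  \<comment> \<open>\<open>STORE a x y\<close>: cell of array \<open>a\<close> at the index in register \<open>x\<close> := register \<open>y\<close>\<close>
  | FLIP nat           \<comment> \<open>\<open>FLIP r\<close>: register \<open>r\<close> := result of a fresh fair coin toss\<close>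
  | SEQ com com
  | COND nat com com
  | LOOP nat com

definition set_reg :: "nat \<Rightarrow> nat \<Rightarrow> ram_state \<Rightarrow> ram_state" where
  "set_reg r v s = s\<lparr>regs := (regs s)(r := v)\<rparr>"

definition set_arr :: "nat \<Rightarrow> nat \<Rightarrow> nat \<Rightarrow> ram_state \<Rightarrow> ram_state" where
  "set_arr a i v s = s\<lparr>arrs := (arrs s)(a := (arrs s a)(i := v))\<rparr>"

text \<open>One step of computation. \<^const>\<open>SKIP\<close> is the halted program.\<close>

primrec step :: "com \<Rightarrow> ram_state \<Rightarrow> (com \<times> ram_state) pmf" where
  "step SKIP s = return_pmf (SKIP, s)"
| "step (SET r c) s = return_pmf (SKIP, set_reg r c s)"
| "step (COPY r x) s = return_pmf (SKIP, set_reg r (regs s x) s)"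
| "step (ADD r x y) s = return_pmf (SKIP, set_reg r (regs s x + regs s y) s)"
| "step (SUB r x y) s = return_pmf (SKIP, set_reg r (regs s x - regs s y) s)"
| "step (LOAD r a x) s = return_pmf (SKIP, set_reg r (arrs s a (regs s x)) s)"
| "step (STORE a x y) s = return_pmf (SKIP, set_arr a (regs s x) (regs s y) s)"
| "step (FLIP r) s =
     map_pmf (\<lambda>b. (SKIP, set_reg r (if b then 1 else 0) s)) (bernoulli_pmf (1 / 2))"
| "step (SEQ p q) s =
     (if p = SKIP then return_pmf (q, s)
      else map_pmf (\<lambda>(p', s'). (SEQ p' q, s')) (step p s))"
| "step (COND r p q) s = return_pmf (if regs s r \<noteq> 0 then p else q, s)"
| "step (LOOP r p) s = return_pmf (if regs s r \<noteq> 0 then SEQ p (LOOP r p) else SKIP, s)"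

primrec run :: "nat \<Rightarrow> com \<Rightarrow> ram_state \<Rightarrow> (com \<times> ram_state) pmf" where
  "run 0 p s = return_pmf (p, s)"
| "run (Suc t) p s = bind_pmf (step p s) (\<lambda>(p', s'). run t p' s')"

text \<open>
  The answer after \<open>t\<close> steps: \<^const>\<open>None\<close> if the program has not halted yet; otherwise
  \<open>Some True\<close> (Yes) or \<open>Some False\<close> (No), according to whether register 0 is nonzero.
\<close>

definition answer :: "nat \<Rightarrow> com \<Rightarrow> ram_state \<Rightarrow> bool option pmf" where
  "answer t p s =
     map_pmf (\<lambda>(p', s'). if p' = SKIP then Some (regs s' 0 \<noteq> 0) else None) (run t p s)"

text \<open>Worst case over all outcomes of the coin tosses.\<close>

definition halts_within :: "nat \<Rightarrow> com \<Rightarrow> ram_state \<Rightarrow> bool" where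
  "halts_within t p s \<longleftrightarrow> None \<notin> set_pmf (answer t p s)"

text \<open>
  The input \<open>(G, k)\<close> with vertex set \<open>{..<n}\<close>: \<open>n\<close> and \<open>k\<close> in registers 1 and 2, and the adjacency
  matrix in row-major order in array 0. Everything else is zero.
\<close>

definition graph_input :: "nat pair_pre_digraph \<Rightarrow> nat \<Rightarrow> nat \<Rightarrow> ram_state" where
  "graph_input G n k =
     \<lparr>regs = (\<lambda>_. 0)(1 := n, 2 := k),
      arrs = (\<lambda>_ _. 0)(0 := (\<lambda>x. if x < n * n \<and> (x div n, x mod n) \<in> parcs G then 1 else 0))\<rparr>"

end

theory Submission
  imports Defs
begin

text \<open>
  A graph has a partial Grundy coloring with at least \<open>k\<close> colors iff at most \<open>k\<^sup>2\<close> of its vertices can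
  be colored properly with \<open>1, \<dots>, k\<close> such that every color has a vertex seeing all smaller ones:
  coloring the other vertices greedily never hurts.

  Suppose that there is no such coloring. Then the graph has a proper coloring with fewer than \<open>k\<close> colors,
  and between any two of its color classes the following patterns are excluded: \<open>k\<close> vertices
  whose neighborhoods differ pairwise in \<open>2 k\<^sup>2\<close> places, and \<open>k\<close> pairs \<open>(x i, y i)\<close> of non-neighbors
  with \<open>y j\<close> adjacent to \<open>x i\<close> for \<open>j < i\<close>. The first one implies that a maximal set \<open>R\<close> of
  vertices whose neighborhoods differ pairwise in more than \<open>4 k\<^sup>3\<close> places has at most \<open>k\<^sup>k\<close> elements.
  The second one implies that for \<open>r \<in> R\<close> all but \<open>4 k\<^sup>6\<close> neighbors of \<open>r\<close> are adjacent to every vertex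
  that is near \<open>r\<close>, that is, whose neighborhood differs from that of \<open>r\<close> in at most \<open>4 k\<^sup>3\<close> places.

  The algorithm computes \<open>R\<close> greedily and answers Yes if one of these bounds is violated. Otherwise it
  guesses which vertices get which color and near which \<open>r \<in> R\<close> each color occurs; a color that occurs
  near \<open>r\<close> is discarded on the common neighbors of all vertices near \<open>r\<close>. This removes all but
  \<open>k\<^bsup>O(1)\<^esup>\<close> neighbors of every vertex of the sought coloring from its color class. If every guess is
  affirmative with probability \<open>2\<^bsup>-16 k\<^sup>2\<^esup>\<close>, then a suitable outcome has at most \<open>2 k\<^sup>2\<close> prescribed
  affirmative and \<open>2\<^bsup>O(k\<^sup>2)\<^esup>\<close> prescribed negative guesses, so its probability is \<open>2\<^bsup>-O(k^4)\<^esup>\<close>.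
  Since a Yes is given only for a verified witness, repeating the trial suffices.
\<close>

section \<open>Witnesses\<close>

text \<open>The value 0 marks uncolored vertices, so an edge may join equal values only if they are
  0: a witness is a proper coloring of the vertices with nonzero value.\<close>

definition grundy_witness :: "'a pair_pre_digraph \<Rightarrow> nat \<Rightarrow> ('a \<Rightarrow> nat) \<Rightarrow> bool" where
  "grundy_witness G k f \<longleftrightarrow>
     (\<forall>(u, v)\<in>parcs G. f u = f v \<longrightarrow> f u = 0) \<and> (\<forall>v\<in>pverts G. f v \<le> k) \<and>
     (\<forall>i\<in>{1..k}. \<exists>v\<in>pverts G. f v = i \<and> (\<forall>j\<in>{1..<i}. \<exists>u. (v, u) \<in> parcs G \<and> f u = j))"

definition nbs :: "'a pair_pre_digraph \<Rightarrow> 'a \<Rightarrow> 'a set" where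
  "nbs G v = {u. (v, u) \<in> parcs G}"

context pair_graph
begin

lemma parcsD: "(u, v) \<in> parcs G \<Longrightarrow> u \<in> pverts G \<and> v \<in> pverts G \<and> u \<noteq> v \<and> (v, u) \<in> parcs G"
  using in_arcsD1[of u v] in_arcsD2[of u v] no_loops'[of u v] arcs_symmetric[of u v] by simp

text \<open>Among all proper extensions of \<open>f\<close> with positive colors, one with least
  color sum behaves like a greedy coloring: a newly colored vertex that misses a smaller color could
  be recolored with it.\<close>

lemma partial_grundy_yes_if_witness:
  assumes f: "grundy_witness G k f"
  shows "partial_grundy_yes G k"
proof -
  define V where "V = pverts G"
  have finV: "finite V" by (simp add: V_def)
  have fpr: "f u = f v \<Longrightarrow> f u = 0" if "(u, v) \<in> parcs G" for u v
    using f that unfolding grundy_witness_def by blast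
  have fk: "f v \<le> k" if "v \<in> V" for v using f that unfolding grundy_witness_def V_def by auto
  define Ext where "Ext c \<longleftrightarrow> (\<forall>v\<in>V. 1 \<le> c v) \<and> (\<forall>(u, v)\<in>parcs G. c u \<noteq> c v) \<and>
     (\<forall>v\<in>V. f v \<noteq> 0 \<longrightarrow> c v = f v)" for c :: "'a \<Rightarrow> nat"
  obtain g :: "'a \<Rightarrow> nat" where g: "inj_on g V" using finV finite_imp_inj_to_nat_seg by blast
  \<comment> \<open>Some extension exists: the uncolored vertices get pairwise distinct colors above
    \<open>k\<close>.\<close>
  have "Ext (\<lambda>v. if f v \<noteq> 0 then f v else k + 1 + g v)"
    unfolding Ext_def
  proof (intro conjI ballI)
    fix e assume "e \<in> parcs G"
    then obtain u v where e: "e = (u, v)" "(u, v) \<in> parcs G" by (cases e) auto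
    from parcsD[OF e(2)] have uv: "u \<in> V" "v \<in> V" "u \<noteq> v" by (auto simp: V_def)
    have "g u \<noteq> g v" using inj_onD[OF g] uv by blast
    then show "case e of (u, v) \<Rightarrow>
        (if f u \<noteq> 0 then f u else k + 1 + g u) \<noteq> (if f v \<noteq> 0 then f v else k + 1 + g v)"
      using fpr[OF e(2)] fk[OF uv(1)] fk[OF uv(2)] e(1) by auto
  qed auto
  then obtain c where c: "Ext c" and cmin: "\<And>d. Ext d \<Longrightarrow> sum c V \<le> sum d V"
    using ex_has_least_nat[of Ext _ "\<lambda>c. sum c V"] by blast
  have cpr: "c u \<noteq> c v" if "(u, v) \<in> parcs G" for u v using c that unfolding Ext_def by blast
  have greedy: "\<exists>u. (v, u) \<in> parcs G \<and> c u = j" if v: "v \<in> V" "f v = 0" "1 \<le> j" "j < c v" for v j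
  proof (rule ccontr)
    assume no: "\<nexists>u. (v, u) \<in> parcs G \<and> c u = j"
    have "(c(v := j)) a \<noteq> (c(v := j)) b" if e: "(a, b) \<in> parcs G" for a b
      using cpr[OF e] parcsD[OF e] no e by (metis fun_upd_apply)
    then have "Ext (c(v := j))"
      using c v unfolding Ext_def by (auto simp del: fun_upd_apply) (auto simp: fun_upd_apply)
    then have "sum c V \<le> sum (c(v := j)) V" by (rule cmin)
    moreover have "sum (c(v := j)) V < sum c V"
      using v finV by (intro sum_strict_mono_ex1) auto
    ultimately show False by simp
  qed
  have new: "f v = 0" if "v \<in> V" "k < c v" for v
    using c fk[OF that(1)] that unfolding Ext_def by (metis not_less)
  \<comment> \<open>Inserting \<open>k\<close> gives \<open>k \<le> m\<close> and keeps the maximum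
    defined for an empty graph.\<close>
  define m where "m = Max (insert k (c ` V))"
  have km: "k \<le> m" and cm: "v \<in> V \<Longrightarrow> c v \<le> m" for v using finV by (auto simp: m_def)
  \<comment> \<open>The color \<open>m > k\<close> occurs at a newly colored vertex, and this vertex
    sees every smaller color.\<close>
  have used: "\<exists>v\<in>V. c v = i" if i: "k < i" "i \<le> m" for i
  proof -
    have "m \<in> insert k (c ` V)" unfolding m_def using finV by (intro Max_in) auto
    then obtain v where v: "v \<in> V" "c v = m" using i by auto
    show ?thesis
    proof (cases "i = m")
      case False
      then obtain u where "(v, u) \<in> parcs G" "c u = i" using greedy[OF v(1) new[OF v(1)], of i] v i by auto
      then show ?thesis using parcsD[of v u] by (auto simp: V_def)
    qed (use v in auto)
  qed
  have "partial_grundy_coloring G m c"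
    unfolding partial_grundy_coloring_def proper_coloring_def
  proof (intro conjI ballI)
    fix v assume "v \<in> pverts G" then show "c v \<in> {1..m}" using c cm by (auto simp: Ext_def V_def)
  next
    fix e assume "e \<in> parcs G" then show "case e of (u, v) \<Rightarrow> c u \<noteq> c v" using cpr by auto
  next
    fix i assume i: "i \<in> {1..m}"
    show "\<exists>v\<in>pverts G. c v = i \<and> (\<forall>j\<in>{1..<i}. \<exists>u\<in>pverts G. (v, u) \<in> parcs G \<and> c u = j)"
    proof (cases "i \<le> k")
      case True
      then have "i \<in> {1..k}" using i by simp
      then obtain v where v: "v \<in> pverts G" "f v = i" "\<And>j. j\<in>{1..<i} \<Longrightarrow> \<exists>u. (v, u) \<in> parcs G \<and> f u = j"
        using f unfolding grundy_witness_def by blast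
      have cf: "c u = j" if "u \<in> pverts G" "f u = j" "j \<ge> 1" for u j
        using c that unfolding Ext_def V_def by auto
      have "\<exists>u\<in>pverts G. (v, u) \<in> parcs G \<and> c u = j" if j: "j \<in> {1..<i}" for j
      proof -
        from v(3)[OF j] obtain u where u: "(v, u) \<in> parcs G" "f u = j" by blast
        then show ?thesis using parcsD[OF u(1)] cf[of u j] j by auto
      qed
      moreover have "c v = i" using cf v i by auto
      ultimately show ?thesis using v(1) by blast
    next
      case False
      then obtain v where v: "v \<in> V" "c v = i" using used[of i] i by auto
      have "f v = 0" using new v False by auto
      then have "\<exists>u\<in>pverts G. (v, u) \<in> parcs G \<and> c u = j" if "j \<in> {1..<i}" for j
        using greedy[OF v(1), of j] v(2) that in_arcsD2 by auto
      then show ?thesis using v unfolding V_def by blast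
    qed
  qed
  then show ?thesis using km unfolding partial_grundy_yes_def by blast
qed

text \<open>Keep for each color \<open>i \<le> k\<close> one vertex \<open>w i\<close> that sees all
  smaller colors, and for each smaller color \<open>j\<close> one such neighbor
  \<open>h i j\<close>; uncolor everything else.\<close>

lemma small_witness_if_partial_grundy_yes:
  assumes "partial_grundy_yes G k"
  obtains f where "grundy_witness G k f" "card {v \<in> pverts G. f v \<noteq> 0} \<le> k\<^sup>2"
proof -
  obtain m c where m: "k \<le> m" and c: "partial_grundy_coloring G m c"
    using assms unfolding partial_grundy_yes_def by blast
  have "\<forall>i\<in>{1..k}. \<exists>v\<in>pverts G. c v = i \<and> (\<forall>j\<in>{1..<i}. \<exists>u. (v, u) \<in> parcs G \<and> c u = j)"
    using c m unfolding partial_grundy_coloring_def by (meson atLeastAtMost_iff order.trans)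
  then obtain w where w: "\<And>i. i \<in> {1..k} \<Longrightarrow> w i \<in> pverts G \<and> c (w i) = i \<and>
      (\<forall>j\<in>{1..<i}. \<exists>u. (w i, u) \<in> parcs G \<and> c u = j)" by metis
  then have "\<forall>i\<in>{1..k}. \<forall>j\<in>{1..<i}. \<exists>u. (w i, u) \<in> parcs G \<and> c u = j" by blast
  then obtain h where h: "\<And>i j. i \<in> {1..k} \<Longrightarrow> j \<in> {1..<i} \<Longrightarrow> (w i, h i j) \<in> parcs G \<and> c (h i j) = j"
    by metis
  \<comment> \<open>The pair \<open>(i, i)\<close> stands for \<open>w i\<close>, and
    \<open>(i, j)\<close> with \<open>j < i\<close> for \<open>h i j\<close>.\<close>
  define P where "P = {(i, j). i \<in> {1..k} \<and> j \<in> {1..i}}"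
  define W where "W = (\<lambda>(i, j). if j = i then w i else h i j) ` P"
  have P: "P \<subseteq> {1..k} \<times> {1..k}" unfolding P_def by auto
  have finP: "finite P" and cardP: "card P \<le> k\<^sup>2"
    using finite_subset[OF P] card_mono[OF _ P] by (auto simp: power2_eq_square)
  define f where "f v = (if v \<in> W then c v else 0)" for v
  have cW: "c v \<in> {1..k}" if "v \<in> W" for v using that w h unfolding W_def P_def by fastforce
  have wW: "w i \<in> W" if "i \<in> {1..k}" for i
    using that unfolding W_def P_def by (intro image_eqI[of _ _ "(i, i)"]) auto
  have hW: "h i j \<in> W" if "i \<in> {1..k}" "j \<in> {1..<i}" for i j
    using that unfolding W_def P_def by (intro image_eqI[of _ _ "(i, j)"]) auto
  have "grundy_witness G k f"
    unfolding grundy_witness_def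
  proof (intro conjI ballI)
    fix e assume "e \<in> parcs G"
    then obtain u v where e: "e = (u, v)" "c u \<noteq> c v"
      using c unfolding partial_grundy_coloring_def proper_coloring_def by (cases e) blast
    then show "case e of (u, v) \<Rightarrow> f u = f v \<longrightarrow> f u = 0" by (simp add: f_def)
  next
    fix v show "f v \<le> k" using cW unfolding f_def by auto
  next
    fix i assume i: "i \<in> {1..k}"
    show "\<exists>v\<in>pverts G. f v = i \<and> (\<forall>j\<in>{1..<i}. \<exists>u. (v, u) \<in> parcs G \<and> f u = j)"
      using w[OF i] wW[OF i] hW[OF i] h[OF i] unfolding f_def
      by (intro bexI[of _ "w i"] conjI ballI) auto
  qed
  moreover have "{v \<in> pverts G. f v \<noteq> 0} \<subseteq> W" unfolding f_def by auto
  then have "card {v \<in> pverts G. f v \<noteq> 0} \<le> card W" using finP by (intro card_mono) (auto simp: W_def)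
  then have "card {v \<in> pverts G. f v \<noteq> 0} \<le> k\<^sup>2"
    using card_image_le[OF finP] cardP unfolding W_def by (meson order.trans)
  ultimately show thesis using that by blast
qed

text \<open>The all-zero function is a witness for \<open>k = 0\<close>, so every graph has some
  partial Grundy coloring; in a no-instance it uses fewer than \<open>k\<close> colors.\<close>

lemma proper_coloring_if_not_yes:
  assumes "\<not> partial_grundy_yes G k"
  obtains m c where "m < k" "proper_coloring G m c"
proof -
  have "partial_grundy_yes G 0"
    by (rule partial_grundy_yes_if_witness[of _ "\<lambda>_. 0"]) (simp add: grundy_witness_def)
  then obtain m c where m: "partial_grundy_coloring G m c" unfolding partial_grundy_yes_def by auto
  then have "\<not> k \<le> m" using assms unfolding partial_grundy_yes_def by blast
  with m show thesis using that[of m c] unfolding partial_grundy_coloring_def by auto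
qed

text \<open>All vertices \<open>x i\<close> lie in one color class of \<open>c\<close> and all vertices \<open>h i j\<close> in another one, so
  giving color \<open>i\<close> to \<open>x i\<close> and color \<open>j\<close> to \<open>h i j\<close> can only conflict between \<open>x j\<close> and \<open>h i j\<close>.\<close>

lemma yes_if_bipartite_pattern:
  assumes c: "proper_coloring G m c"
    and x: "\<And>i. i \<in> {1..k} \<Longrightarrow> x i \<in> pverts G \<and> c (x i) = a"
    and h: "\<And>i j. i \<in> {1..k} \<Longrightarrow> j \<in> {1..<i} \<Longrightarrow> h i j \<in> nbs G (x i) - nbs G (x j) \<and> c (h i j) = b"
    and hj: "\<And>i j i' j'. i \<in> {1..k} \<Longrightarrow> j \<in> {1..<i} \<Longrightarrow> i' \<in> {1..k} \<Longrightarrow> j' \<in> {1..<i'} \<Longrightarrow>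
      h i j = h i' j' \<Longrightarrow> j = j'"
  shows "partial_grundy_yes G k"
proof -
  have pr: "c u \<noteq> c v" if "(u, v) \<in> parcs G" for u v
    using c that unfolding proper_coloring_def by blast
  have inj: "i = j" if "i \<in> {1..k}" "j \<in> {1..k}" "x i = x j" for i j
    using h[of i j] h[of j i] that by (cases i j rule: linorder_cases) auto
  \<comment> \<open>Different \<open>i\<close> may share the vertex \<open>h i j\<close>, so color
    \<open>j\<close> is assigned through the set \<open>H j\<close> of all vertices meant to get it;
    by \<open>hj\<close> these sets are disjoint for distinct positive \<open>j\<close>.\<close>
  define H where "H j = {h i j | i. i \<in> {1..k} \<and> j < i}" for j
  define f where "f v = (if \<exists>i\<in>{1..k}. v = x i then THE i. i \<in> {1..k} \<and> v = x i
     else if \<exists>j\<ge>1. v \<in> H j then THE j. 1 \<le> j \<and> v \<in> H j else 0)" for v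
  have fx: "f (x i) = i" if "i \<in> {1..k}" for i
    using that inj unfolding f_def by (auto intro!: the_equality)
  \<comment> \<open>An edge joins \<open>x i\<close> to \<open>h i j\<close>, so the two classes
    differ and no \<open>h i j\<close> is one of the \<open>x l\<close>.\<close>
  have ab: "a \<noteq> b" if "i \<in> {1..k}" "j \<in> {1..<i}" for i j
    using h[OF that] x[OF that(1)] pr unfolding nbs_def by auto
  have hx: "h i j \<noteq> x l" if "i \<in> {1..k}" "j \<in> {1..<i}" "l \<in> {1..k}" for i j l
    using h[OF that(1,2)] x[OF that(3)] ab[OF that(1,2)] by metis
  have fh: "f (h i j) = j" if ij: "i \<in> {1..k}" "j \<in> {1..<i}" for i j
  proof -
    have "h i j \<in> H j" using ij unfolding H_def by auto
    moreover have "j' = j" if "1 \<le> j'" "h i j \<in> H j'" for j'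
      using that hj[OF ij] unfolding H_def by fastforce
    ultimately have "(THE j'. 1 \<le> j' \<and> h i j \<in> H j') = j" using ij by (intro the_equality) auto
    then show ?thesis using hx[OF ij] \<open>h i j \<in> H j\<close> ij unfolding f_def by auto
  qed
  have cases: "f v = 0 \<or> f v \<in> {1..k} \<and> x (f v) = v \<or>
      (\<exists>i. i \<in> {1..k} \<and> f v \<in> {1..<i} \<and> h i (f v) = v)" for v
  proof -
    consider "\<exists>i\<in>{1..k}. v = x i" | "\<exists>j\<ge>1. v \<in> H j" | "f v = 0" unfolding f_def by metis
    then show ?thesis
    proof cases
      case 1 then show ?thesis using fx by auto
    next
      case 2
      then obtain i j where "i \<in> {1..k}" "j \<in> {1..<i}" "v = h i j" unfolding H_def by auto
      then show ?thesis using fh by auto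
    qed auto
  qed
  have "grundy_witness G k f"
    unfolding grundy_witness_def
  proof (intro conjI ballI)
    fix e assume "e \<in> parcs G"
    then obtain u v where e: "e = (u, v)" "(u, v) \<in> parcs G" by (cases e) auto
    then have e': "(v, u) \<in> parcs G" using parcsD by blast
    have "f u = 0" if "f u = f v"
    proof (rule ccontr)
      assume "f u \<noteq> 0"
      then have nz: "f u \<noteq> 0" "f v \<noteq> 0" using that by auto
      have nadj: "(x j, h i j) \<notin> parcs G" if "i \<in> {1..k}" "j \<in> {1..<i}" for i j
        using h[OF that] unfolding nbs_def by blast
      have xu: "x (f u) = u \<and> f u \<in> {1..k} \<or> (\<exists>i. i \<in> {1..k} \<and> f u \<in> {1..<i} \<and> h i (f u) = u)"
        and xv: "x (f u) = v \<and> f u \<in> {1..k} \<or> (\<exists>i. i \<in> {1..k} \<and> f u \<in> {1..<i} \<and> h i (f u) = v)"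
        using cases[of u] cases[of v] nz unfolding that[symmetric] by argo+
      from xu show False
      proof (elim disjE exE conjE)
        assume u: "x (f u) = u" "f u \<in> {1..k}"
        from xv show False
        proof (elim disjE exE conjE)
          assume "x (f u) = v" then show False using u parcsD[OF e(2)] by simp
        next
          fix i assume "i \<in> {1..k}" "f u \<in> {1..<i}" "h i (f u) = v"
          then show False using nadj[of i "f u"] u(1) e(2) by simp
        qed
      next
        fix i assume u: "i \<in> {1..k}" "f u \<in> {1..<i}" "h i (f u) = u"
        from xv show False
        proof (elim disjE exE conjE)
          assume "x (f u) = v" then show False using u nadj[of i "f u"] e' by simp
        next
          fix i' assume v: "i' \<in> {1..k}" "f u \<in> {1..<i'}" "h i' (f u) = v"
          then have "c u = b" "c v = b" using h[OF u(1,2)] h[OF v(1,2)] u(3) by auto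
          then show False using pr[OF e(2)] by simp
        qed
      qed
    qed
    then show "case e of (u, v) \<Rightarrow> f u = f v \<longrightarrow> f u = 0" using e by simp
  next
    fix v show "f v \<le> k" using cases[of v] by auto
  next
    fix i assume i: "i \<in> {1..k}"
    show "\<exists>v\<in>pverts G. f v = i \<and> (\<forall>j\<in>{1..<i}. \<exists>u. (v, u) \<in> parcs G \<and> f u = j)"
      using x[OF i] fx[OF i] fh[OF i] h[OF i] unfolding nbs_def
      by (intro bexI[of _ "x i"] conjI ballI) auto
  qed
  then show ?thesis by (rule partial_grundy_yes_if_witness)
qed

end

section \<open>Neighborhoods in no-instances\<close>

text \<open>A greedy case of Hall's theorem: each set has as many elements as there are indices, so
  the values already taken never exhaust it.\<close>

lemma distinct_choice:
  assumes "finite P" "\<And>p. p \<in> P \<Longrightarrow> card P \<le> card (S p)"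
  obtains h where "inj_on h P" "\<And>p. p \<in> P \<Longrightarrow> h p \<in> S p"
proof -
  have "\<exists>h. inj_on h P \<and> (\<forall>p\<in>P. h p \<in> S p)"
    using assms
  proof (induction P rule: finite_induct)
    case (insert p P)
    then obtain h where h: "inj_on h P" "\<forall>p\<in>P. h p \<in> S p"
      by (metis card_insert_le insertCI order_trans)
    have "card (h ` P) < card (S p)"
      using insert.prems[of p] insert.hyps card_image_le[of P h] by simp
    then obtain u where u: "u \<in> S p" "u \<notin> h ` P"
      using insert.hyps(1) by (metis card_mono finite_imageI leD subsetI)
    have "inj_on (h(p := u)) (insert p P) \<and> (\<forall>q\<in>insert p P. (h(p := u)) q \<in> S q)"
      using h u insert.hyps(2) by (auto simp: inj_on_def)
    then show ?case by blast
  qed auto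
  then show thesis using that by blast
qed

text \<open>With \<open>P\<close> read as being far apart, \<open>T\<close> is a separated set that
  is also a net: elements enter one at a time, and a rejected one is not far from some member of
  \<open>T\<close>.\<close>

lemma maximal_separated_subset:
  assumes "finite A" and sym: "\<And>x y. P x y \<Longrightarrow> P y x"
  obtains T where "T \<subseteq> A" "\<And>x y. x \<in> T \<Longrightarrow> y \<in> T \<Longrightarrow> x \<noteq> y \<Longrightarrow> P x y"
    "\<And>v. v \<in> A \<Longrightarrow> \<exists>t\<in>T. v = t \<or> \<not> P v t"
proof -
  have "\<exists>T\<subseteq>A. (\<forall>x\<in>T. \<forall>y\<in>T. x \<noteq> y \<longrightarrow> P x y) \<and> (\<forall>v\<in>A. \<exists>t\<in>T. v = t \<or> \<not> P v t)"
    using \<open>finite A\<close>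
  proof (induction A rule: finite_induct)
    case (insert a A)
    then obtain T where T: "T \<subseteq> A" "\<forall>x\<in>T. \<forall>y\<in>T. x \<noteq> y \<longrightarrow> P x y" "\<forall>v\<in>A. \<exists>t\<in>T. v = t \<or> \<not> P v t"
      by blast
    show ?case
    proof (cases "\<exists>t\<in>T. \<not> P a t")
      case True
      then have "\<forall>v\<in>insert a A. \<exists>t\<in>T. v = t \<or> \<not> P v t" using T(3) by auto
      then show ?thesis using T(1,2) by (intro exI[of _ T]) auto
    next
      case False
      then have "\<forall>x\<in>insert a T. \<forall>y\<in>insert a T. x \<noteq> y \<longrightarrow> P x y" using T(2) sym by auto
      moreover have "\<forall>v\<in>insert a A. \<exists>t\<in>insert a T. v = t \<or> \<not> P v t" using T(3) by auto
      ultimately show ?thesis using T(1) by (intro exI[of _ "insert a T"]) auto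
    qed
  qed auto
  then show thesis using that by metis
qed

text \<open>The Hamming distance between the adjacency rows of \<open>x\<close> and
  \<open>y\<close>.\<close>

definition nb_dist :: "'a pair_pre_digraph \<Rightarrow> 'a \<Rightarrow> 'a \<Rightarrow> nat" where
  "nb_dist G x y = card ((nbs G x - nbs G y) \<union> (nbs G y - nbs G x))"

section \<open>Two forbidden patterns between color classes and their counting consequences\<close>

context pair_graph
begin

lemma nbs_subset: "nbs G v \<subseteq> pverts G"
  unfolding nbs_def using parcsD by blast

lemma finite_nbs [simp]: "finite (nbs G v)"
  using nbs_subset finite_subset by fastforce

text \<open>Order \<open>T\<close> by the size of the neighborhood inside class \<open>b\<close>. Of
  two vertices, the one with the larger neighborhood accounts for at least half of the symmetric
  difference, that is \<open>k^2\<close> vertices. This suffices to choose all \<open>h i j\<close>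
  distinct, since there are at most \<open>k^2\<close> pairs.\<close>

lemma yes_if_separated:
  fixes b :: nat
  defines "N \<equiv> \<lambda>x c. {u \<in> nbs G x. c u = b}"
  assumes c: "proper_coloring G m c"
    and T: "T \<subseteq> pverts G" "card T = k" "\<And>x. x \<in> T \<Longrightarrow> c x = a"
    and sep: "\<And>x y. x \<in> T \<Longrightarrow> y \<in> T \<Longrightarrow> x \<noteq> y \<Longrightarrow> 2 * k\<^sup>2 \<le> card ((N x c - N y c) \<union> (N y c - N x c))"
  shows "partial_grundy_yes G k"
proof -
  have finT: "finite T" using T(1) finite_subset by fastforce
  have finN: "finite (N x c)" for x unfolding N_def by simp
  obtain ys where ys: "set ys = T" "distinct ys" using finite_distinct_list[OF finT] by blast
  define xs where "xs = sort_key (\<lambda>x. card (N x c)) ys"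
  have xs: "set xs = T" "distinct xs" "length xs = k" "sorted (map (\<lambda>x. card (N x c)) xs)"
    using ys T(2) distinct_card[OF ys(2)] unfolding xs_def by auto
  define x where "x i = xs ! (i - 1)" for i
  have xT: "x i \<in> T" if "i \<in> {1..k}" for i using that xs unfolding x_def by (auto intro!: nth_mem)
  have gap: "k\<^sup>2 \<le> card (N (x i) c - N (x j) c)" if ij: "i \<in> {1..k}" "j \<in> {1..<i}" for i j
  proof -
    have "i - 1 < length xs" "j - 1 < length xs" "i - 1 \<noteq> j - 1" using ij xs(3) by auto
    then have "x i \<noteq> x j" using nth_eq_iff_index_eq[OF xs(2)] unfolding x_def by blast
    then have s: "2 * k\<^sup>2 \<le> card ((N (x i) c - N (x j) c) \<union> (N (x j) c - N (x i) c))"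
      using xT ij by (intro sep) auto
    have "card (N (x j) c) \<le> card (N (x i) c)"
      using ij xs sorted_nth_mono[OF xs(4), of "j - 1" "i - 1"] unfolding x_def by auto
    then have "card (N (x j) c - N (x i) c) \<le> card (N (x i) c - N (x j) c)"
      using finN by (simp add: card_le_sym_Diff)
    then show ?thesis using s card_Un_le[of "N (x i) c - N (x j) c" "N (x j) c - N (x i) c"] by linarith
  qed
  define P where "P = {(i, j). i \<in> {1..k} \<and> j \<in> {1..<i}}"
  have P: "P \<subseteq> {1..k} \<times> {1..k}" unfolding P_def by auto
  have finP: "finite P" and cardP: "card P \<le> k\<^sup>2"
    using finite_subset[OF P] card_mono[OF _ P] by (auto simp: power2_eq_square)
  obtain h where h: "inj_on h P" "\<And>p. p \<in> P \<Longrightarrow> h p \<in> (case p of (i, j) \<Rightarrow> N (x i) c - N (x j) c)"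
  proof (rule distinct_choice[OF finP, of "\<lambda>(i, j). N (x i) c - N (x j) c"])
    fix p assume "p \<in> P"
    then obtain i j where p: "p = (i, j)" "i \<in> {1..k}" "j \<in> {1..<i}" unfolding P_def by blast
    then show "card P \<le> card (case p of (i, j) \<Rightarrow> N (x i) c - N (x j) c)"
      using gap[OF p(2,3)] cardP by simp
  qed blast
  have hp: "h (i, j) \<in> N (x i) c - N (x j) c" if "i \<in> {1..k}" "j \<in> {1..<i}" for i j
    using h(2)[of "(i, j)"] that unfolding P_def by simp
  show ?thesis
  proof (rule yes_if_bipartite_pattern[OF c, where x = x and h = "\<lambda>i j. h (i, j)"])
    show "x i \<in> pverts G \<and> c (x i) = a" if "i \<in> {1..k}" for i using xT[OF that] T by auto
    show "h (i, j) \<in> nbs G (x i) - nbs G (x j) \<and> c (h (i, j)) = b" if "i \<in> {1..k}" "j \<in> {1..<i}" for i j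
      using hp[OF that] unfolding N_def by blast
    show "j = j'" if "i \<in> {1..k}" "j \<in> {1..<i}" "i' \<in> {1..k}" "j' \<in> {1..<i'}" "h (i, j) = h (i', j')" for i j i' j'
      using inj_onD[OF h(1) that(5)] that unfolding P_def by auto
  qed
qed

text \<open>A vertex of \<open>R\<close> is encoded by its color and, for each color
  \<open>b\<close>, by a close member of a net of fewer than \<open>k\<close> vertices in its class.
  Equal codes force distance at most \<open>4 * k ^ 3\<close>, so the encoding is injective, and
  there are at most \<open>m * k ^ m\<close> codes.\<close>

lemma card_separated_le:
  assumes no: "\<not> partial_grundy_yes G k"
    and R: "R \<subseteq> pverts G" "\<And>x y. x \<in> R \<Longrightarrow> y \<in> R \<Longrightarrow> x \<noteq> y \<Longrightarrow> 4 * k ^ 3 < nb_dist G x y"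
  shows "card R \<le> k ^ k"
proof -
  obtain m c where m: "m < k" and c: "proper_coloring G m c"
    using proper_coloring_if_not_yes[OF no] .
  have cm: "c v \<in> {1..m}" if "v \<in> pverts G" for v using c that unfolding proper_coloring_def by blast
  have finR: "finite R" using R(1) finite_subset by fastforce
  define N where "N b x = {u \<in> nbs G x. c u = b}" for b x
  define D where "D b x y = (N b x - N b y) \<union> (N b y - N b x)" for b x y
  have finD: "finite (D b x y)" for b x y unfolding D_def N_def by simp
  define far where "far b x y \<longleftrightarrow> 2 * k\<^sup>2 \<le> card (D b x y)" for b x y
  \<comment> \<open>The net is a maximal set of vertices that are pairwise far with respect to class
    \<open>b\<close>; \<open>k\<close> members would form the first forbidden pattern.\<close>
  have "\<exists>T. T \<subseteq> {v \<in> R. c v = a} \<and> card T < k \<and> (\<forall>v\<in>R. c v = a \<longrightarrow> (\<exists>t\<in>T. v = t \<or> \<not> far b v t))" for a b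
  proof -
    obtain T where T: "T \<subseteq> {v \<in> R. c v = a}" "\<And>x y. x \<in> T \<Longrightarrow> y \<in> T \<Longrightarrow> x \<noteq> y \<Longrightarrow> far b x y"
      "\<And>v. v \<in> {v \<in> R. c v = a} \<Longrightarrow> \<exists>t\<in>T. v = t \<or> \<not> far b v t"
      using maximal_separated_subset[of "{v \<in> R. c v = a}" "far b"] finR
      by (auto simp: far_def D_def Un_commute)
    have "card T < k"
    proof (rule ccontr)
      assume "\<not> card T < k"
      then obtain T' where T': "T' \<subseteq> T" "card T' = k" by (meson not_less obtain_subset_with_card_n)
      have "partial_grundy_yes G k"
      proof (rule yes_if_separated[OF c])
        show "T' \<subseteq> pverts G" using T' T(1) R(1) by blast
        show "c x = a" if "x \<in> T'" for x using that T' T(1) by blast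
        show "2 * k\<^sup>2 \<le> card (({u \<in> nbs G x. c u = b} - {u \<in> nbs G y. c u = b}) \<union>
            ({u \<in> nbs G y. c u = b} - {u \<in> nbs G x. c u = b}))" if "x \<in> T'" "y \<in> T'" "x \<noteq> y" for x y
          using T(2)[of x y] T' that unfolding far_def D_def N_def by blast
      qed fact
      with no show False by blast
    qed
    then show ?thesis using T by blast
  qed
  then obtain T where T: "\<And>a b. T a b \<subseteq> {v \<in> R. c v = a}" "\<And>a b. card (T a b) < k"
    "\<And>a b v. v \<in> R \<Longrightarrow> c v = a \<Longrightarrow> \<exists>t\<in>T a b. v = t \<or> \<not> far b v t" by metis
  define t where "t b v = (SOME t. t \<in> T (c v) b \<and> (v = t \<or> \<not> far b v t))" for b v
  have t: "t b v \<in> T (c v) b \<and> (v = t b v \<or> \<not> far b v (t b v))" if "v \<in> R" for b v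
    unfolding t_def by (rule someI_ex) (use T(3)[OF that refl, of b] in blast)
  have finT: "finite (T a b)" for a b using finite_subset[OF T(1)] finR by simp
  have near: "card (D b v (t b v)) \<le> 2 * k\<^sup>2" if "v \<in> R" for b v
    using t[OF that, of b] unfolding far_def D_def by auto
  define g where "g v = (c v, \<lambda>b\<in>{1..m}. t b v)" for v
  have "inj_on g R"
  proof (rule inj_onI, rule ccontr)
    fix x y assume xy: "x \<in> R" "y \<in> R" "g x = g y" "x \<noteq> y"
    have tt: "t b x = t b y" if "b \<in> {1..m}" for b
      using xy(3) that unfolding g_def by (metis Pair_inject restrict_apply')
    \<comment> \<open>In class \<open>b\<close> both vertices differ in at most
      \<open>2 * k^2\<close> places from the shared net point; fewer than \<open>k\<close> classes
      then contribute at most \<open>4 * k ^ 3\<close> in total.\<close>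
    have le: "card (D b x y) \<le> 4 * k\<^sup>2" if "b \<in> {1..m}" for b
    proof -
      have "D b x y \<subseteq> D b x (t b x) \<union> D b y (t b y)" unfolding tt[OF that] D_def by blast
      then have "card (D b x y) \<le> card (D b x (t b x) \<union> D b y (t b y))"
        using finD by (intro card_mono) auto
      also have "\<dots> \<le> 4 * k\<^sup>2"
        using card_Un_le[of "D b x (t b x)" "D b y (t b y)"] near[OF xy(1), of b] near[OF xy(2), of b] by simp
      finally show ?thesis .
    qed
    have "(nbs G x - nbs G y) \<union> (nbs G y - nbs G x) \<subseteq> (\<Union>b\<in>{1..m}. D b x y)"
      unfolding D_def N_def using nbs_subset cm by fastforce
    then have "nb_dist G x y \<le> card (\<Union>b\<in>{1..m}. D b x y)"
      unfolding nb_dist_def using finD by (intro card_mono) auto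
    also have "\<dots> \<le> (\<Sum>b\<in>{1..m}. card (D b x y))" by (rule card_UN_le) simp
    also have "\<dots> \<le> (\<Sum>b\<in>{1..m}. 4 * k\<^sup>2)" by (rule sum_mono) (rule le)
    also have "\<dots> \<le> k * (4 * k\<^sup>2)" using m by simp
    finally show False using R(2)[OF xy(1,2,4)] by (simp add: power2_eq_square power3_eq_cube)
  qed
  have cardPi: "card (PiE {1..m} (T a)) \<le> k ^ m" for a
  proof -
    have "card (PiE {1..m} (T a)) = (\<Prod>b\<in>{1..m}. card (T a b))" by (rule card_PiE) simp
    also have "\<dots> \<le> (\<Prod>b\<in>{1..m}. k)" using T(2) by (intro prod_mono) (auto simp: less_imp_le)
    finally show ?thesis by simp
  qed
  have "g ` R \<subseteq> (SIGMA a : {1..m}. PiE {1..m} (T a))"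
    unfolding g_def using t cm R(1) by auto
  then have "card (g ` R) \<le> card (SIGMA a : {1..m}. PiE {1..m} (T a))"
    using finT by (intro card_mono finite_SigmaI finite_PiE) auto
  also have "\<dots> = (\<Sum>a\<in>{1..m}. card (PiE {1..m} (T a)))"
    using finT by (intro card_SigmaI) (auto intro!: finite_PiE)
  also have "\<dots> \<le> (\<Sum>a\<in>{1..m}. k ^ m)" by (rule sum_mono) (rule cardPi)
  also have "\<dots> = m * k ^ m" by simp
  also have "\<dots> \<le> k * k ^ m" using m by simp
  also have "\<dots> \<le> k ^ k" using m power_increasing[of "Suc m" k k] by simp
  finally show ?thesis using card_image[OF \<open>inj_on g R\<close>] by simp
qed

text \<open>Choosing the pairs greedily, from the highest color downwards, one only has to discard the
  non-neighbors of the vertices \<open>x y\<close> chosen so far.\<close>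

lemma anti_matching_chain:
  assumes "finite E" "k * \<tau> < card E"
    and "\<And>y. y \<in> E \<Longrightarrow> card {y' \<in> E. y' \<notin> nbs G (x y)} \<le> \<tau>"
    and "\<And>y. y \<in> E \<Longrightarrow> y \<notin> nbs G (x y)"
  obtains z where "\<And>i. i \<in> {1..k} \<Longrightarrow> z i \<in> E"
    "\<And>i j. i \<in> {1..k} \<Longrightarrow> j \<in> {1..<i} \<Longrightarrow> z j \<in> nbs G (x (z i))"
proof -
  have "\<exists>z. (\<forall>i\<in>{1..k}. z i \<in> E) \<and> (\<forall>i\<in>{1..k}. \<forall>j\<in>{1..<i}. z j \<in> nbs G (x (z i)))"
    using assms
  proof (induction k arbitrary: E)
    case (Suc k)
    then obtain y where y: "y \<in> E" by fastforce
    define E' where "E' = {y' \<in> E. y' \<in> nbs G (x y)}"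
    have E': "E' = E - {y' \<in> E. y' \<notin> nbs G (x y)}" unfolding E'_def by blast
    have "k * \<tau> < card E'"
      using Suc.prems(1,2) Suc.prems(3)[OF y] unfolding E' by (subst card_Diff_subset) auto
    moreover have "card {y' \<in> E'. y' \<notin> nbs G (x w)} \<le> \<tau>" if "w \<in> E'" for w
    proof -
      have "card {y' \<in> E'. y' \<notin> nbs G (x w)} \<le> card {y' \<in> E. y' \<notin> nbs G (x w)}"
        using Suc.prems(1) unfolding E'_def by (intro card_mono) auto
      then show ?thesis using Suc.prems(3)[of w] that unfolding E'_def by auto
    qed
    ultimately obtain z where z: "\<forall>i\<in>{1..k}. z i \<in> E'" "\<forall>i\<in>{1..k}. \<forall>j\<in>{1..<i}. z j \<in> nbs G (x (z i))"
      using Suc.IH[of E'] Suc.prems(1,4) unfolding E'_def by auto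
    have "(\<forall>i\<in>{1..Suc k}. (z(Suc k := y)) i \<in> E) \<and>
        (\<forall>i\<in>{1..Suc k}. \<forall>j\<in>{1..<i}. (z(Suc k := y)) j \<in> nbs G (x ((z(Suc k := y)) i)))"
      using z y unfolding E'_def by (auto simp: le_Suc_eq)
    then show ?case by blast
  qed auto
  then show thesis using that by blast
qed

text \<open>Attach to every exceptional \<open>y\<close> a non-neighbor \<open>x y\<close> in
  \<open>Q\<close>. By pigeonhole over the color pairs \<open>(c (x y), c y)\<close>, more than
  \<open>k * \<tau>\<close> of them lie in two fixed classes, and \<open>anti_matching_chain\<close>
  extracts the second forbidden pattern there.\<close>

lemma card_exceptional_le:
  assumes no: "\<not> partial_grundy_yes G k"
    and Q: "Q \<subseteq> pverts G" "\<And>x. x \<in> Q \<Longrightarrow> card (nbs G r - nbs G x) \<le> \<tau>"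
  shows "card {y \<in> nbs G r. \<exists>x\<in>Q. y \<notin> nbs G x} \<le> k ^ 3 * \<tau>"
proof (rule ccontr)
  define E where "E = {y \<in> nbs G r. \<exists>x\<in>Q. y \<notin> nbs G x}"
  assume "\<not> card {y \<in> nbs G r. \<exists>x\<in>Q. y \<notin> nbs G x} \<le> k ^ 3 * \<tau>"
  then have big: "k ^ 3 * \<tau> < card E" unfolding E_def by simp
  have finE: "finite E" unfolding E_def by simp
  obtain m c where m: "m < k" and c: "proper_coloring G m c"
    using proper_coloring_if_not_yes[OF no] .
  have cm: "c v \<in> {1..m}" if "v \<in> pverts G" for v using c that unfolding proper_coloring_def by blast
  have "\<forall>y\<in>E. \<exists>x\<in>Q. y \<notin> nbs G x" unfolding E_def by blast
  then obtain x where x: "\<And>y. y \<in> E \<Longrightarrow> x y \<in> Q \<and> y \<notin> nbs G (x y)" by metis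
  define F where "F p = {y \<in> E. (c (x y), c y) = p}" for p
  have "\<exists>p\<in>{1..m} \<times> {1..m}. k * \<tau> < card (F p)"
  proof (rule ccontr)
    assume small: "\<not> ?thesis"
    have "E \<subseteq> (\<Union>p\<in>{1..m} \<times> {1..m}. F p)"
      using cm x Q(1) nbs_subset unfolding F_def E_def by fastforce
    then have "card E \<le> card (\<Union>p\<in>{1..m} \<times> {1..m}. F p)"
      using finE by (intro card_mono) (auto simp: F_def)
    also have "\<dots> \<le> (\<Sum>p\<in>{1..m} \<times> {1..m}. card (F p))" by (rule card_UN_le) simp
    also have "\<dots> \<le> (\<Sum>p\<in>{1..m} \<times> {1..m}. k * \<tau>)" using small by (intro sum_mono) (metis not_less)
    also have "\<dots> \<le> k * k * (k * \<tau>)" using m by (simp add: mult_le_mono)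
    finally show False using big by (simp add: power3_eq_cube)
  qed
  then obtain p where p: "k * \<tau> < card (F p)" by blast
  obtain z where z: "\<And>i. i \<in> {1..k} \<Longrightarrow> z i \<in> F p"
    "\<And>i j. i \<in> {1..k} \<Longrightarrow> j \<in> {1..<i} \<Longrightarrow> z j \<in> nbs G (x (z i))"
  proof (rule anti_matching_chain[OF _ p])
    show "finite (F p)" using finE unfolding F_def by simp
    fix y assume y: "y \<in> F p"
    then have yE: "y \<in> E" unfolding F_def by simp
    have "{y' \<in> F p. y' \<notin> nbs G (x y)} \<subseteq> nbs G r - nbs G (x y)" unfolding F_def E_def by blast
    then have "card {y' \<in> F p. y' \<notin> nbs G (x y)} \<le> card (nbs G r - nbs G (x y))"
      by (intro card_mono) auto
    then show "card {y' \<in> F p. y' \<notin> nbs G (x y)} \<le> \<tau>" using Q(2) x[OF yE] by fastforce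
    show "y \<notin> nbs G (x y)" using x[OF yE] by blast
  qed blast
  have zx: "x (z i) \<in> Q" "z i \<notin> nbs G (x (z i))" "c (x (z i)) = fst p" "c (z i) = snd p" if "i \<in> {1..k}" for i
    using z(1)[OF that] x[of "z i"] unfolding F_def by auto
  have "partial_grundy_yes G k"
  proof (rule yes_if_bipartite_pattern[OF c, where x = "\<lambda>i. x (z i)" and h = "\<lambda>i j. z j"])
    show "x (z i) \<in> pverts G \<and> c (x (z i)) = fst p" if "i \<in> {1..k}" for i
      using zx[OF that] Q(1) by blast
    show "z j \<in> nbs G (x (z i)) - nbs G (x (z j)) \<and> c (z j) = snd p" if "i \<in> {1..k}" "j \<in> {1..<i}" for i j
      using zx[of j] z(2)[OF that] that by auto
    \<comment> \<open>For \<open>j < j'\<close> the vertex \<open>z j\<close> is adjacent to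
      \<open>x (z j')\<close> and \<open>z j'\<close> is not, so \<open>z\<close> is
      injective.\<close>
    show "j = j'" if "i \<in> {1..k}" "j \<in> {1..<i}" "i' \<in> {1..k}" "j' \<in> {1..<i'}" "z j = z j'" for i j i' j'
      using z(2)[of j j'] z(2)[of j' j] zx(2)[of j] zx(2)[of j'] that
      by (cases j j' rule: linorder_cases) auto
  qed
  with no show False by blast
qed

end

section \<open>Random trials\<close>

definition near :: "'a pair_pre_digraph \<Rightarrow> nat \<Rightarrow> 'a \<Rightarrow> 'a set" where
  "near G k r = {x \<in> pverts G. nb_dist G x r \<le> 4 * k ^ 3}"

definition common :: "'a pair_pre_digraph \<Rightarrow> nat \<Rightarrow> 'a \<Rightarrow> 'a set" where
  "common G k r = {y \<in> nbs G r. \<forall>x\<in>near G k r. y \<in> nbs G x}"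

text \<open>In a trial, bit \<open>D (v, j)\<close> with \<open>j < k\<close> proposes color \<open>j\<close> for the vertex \<open>v\<close>, and bit
  \<open>D (r, k + j)\<close> guesses that color \<open>j\<close> occurs near the representative \<open>r\<close>, so that no vertex
  of \<^term>\<open>common G k r\<close> may have color \<open>j\<close>. Here colors are counted from \<open>0\<close>.\<close>

definition survives :: "'a pair_pre_digraph \<Rightarrow> nat \<Rightarrow> 'a set \<Rightarrow> ('a \<times> nat) set \<Rightarrow> 'a \<Rightarrow> nat \<Rightarrow> bool" where
  "survives G k R D v j \<longleftrightarrow> (v, j) \<in> D \<and> (\<forall>r\<in>R. (r, k + j) \<in> D \<longrightarrow> v \<notin> common G k r)"

text \<open>The tests on the neighbors and on the other colors make this a proper partial coloring
  for every bit set \<open>D\<close>, so acceptance is a certificate however the bits were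
  drawn.\<close>

definition colored :: "'a pair_pre_digraph \<Rightarrow> nat \<Rightarrow> 'a set \<Rightarrow> ('a \<times> nat) set \<Rightarrow> 'a \<Rightarrow> nat \<Rightarrow> bool" where
  "colored G k R D v j \<longleftrightarrow> survives G k R D v j \<and> (\<forall>u\<in>nbs G v. \<not> survives G k R D u j) \<and>
     (\<forall>j'<k. j' \<noteq> j \<longrightarrow> \<not> survives G k R D v j')"

definition accepts :: "'a pair_pre_digraph \<Rightarrow> nat \<Rightarrow> 'a set \<Rightarrow> ('a \<times> nat) set \<Rightarrow> bool" where
  "accepts G k R D \<longleftrightarrow> (\<forall>i<k. \<exists>v\<in>pverts G. colored G k R D v i \<and>
     (\<forall>j<i. \<exists>u\<in>nbs G v. colored G k R D u j))"

context pair_graph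
begin

lemma yes_if_accepts:
  assumes "accepts G k R D"
  shows "partial_grundy_yes G k"
proof -
  \<comment> \<open>Colors shift from \<open>{0..<k}\<close> to \<open>{1..k}\<close>, since 0 means
    uncolored in a witness.\<close>
  define f where "f v = (if \<exists>j<k. colored G k R D v j then Suc (THE j. j < k \<and> colored G k R D v j) else 0)" for v
  have f: "f v = Suc j" if "j < k" "colored G k R D v j" for v j
  proof -
    have "(THE j. j < k \<and> colored G k R D v j) = j"
      using that by (intro the_equality) (auto simp: colored_def)
    then show ?thesis using that unfolding f_def by auto
  qed
  have f': "\<exists>j<k. f v = Suc j \<and> colored G k R D v j" if "f v \<noteq> 0" for v
    using that f unfolding f_def by (metis (no_types, lifting))
  have "grundy_witness G k f"
    unfolding grundy_witness_def
  proof (intro conjI ballI)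
    fix e assume "e \<in> parcs G"
    then obtain u v where e: "e = (u, v)" "(u, v) \<in> parcs G" by (cases e) auto
    have "f u = 0" if eq: "f u = f v"
    proof (rule ccontr)
      assume nz: "f u \<noteq> 0"
      obtain i j where "f u = Suc i" "colored G k R D u i" "f v = Suc j" "colored G k R D v j"
        using f'[OF nz] f'[OF nz[unfolded eq]] by blast
      then show False using eq e(2) unfolding colored_def nbs_def by auto
    qed
    then show "case e of (u, v) \<Rightarrow> f u = f v \<longrightarrow> f u = 0" using e(1) by simp
  next
    fix v show "f v \<le> k" using f'[of v] by (cases "f v = 0") auto
  next
    fix i assume i: "i \<in> {1..k}"
    then have "i - 1 < k" by auto
    then obtain v where v: "v \<in> pverts G" "colored G k R D v (i - 1)"
      "\<And>j. j < i - 1 \<Longrightarrow> \<exists>u\<in>nbs G v. colored G k R D u j" using assms unfolding accepts_def by metis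
    have "\<exists>u. (v, u) \<in> parcs G \<and> f u = j" if j: "j \<in> {1..<i}" for j
    proof -
      have "j - 1 < i - 1" using j by auto
      then obtain u where "u \<in> nbs G v" "colored G k R D u (j - 1)" using v(3) by blast
      then show ?thesis using f[of "j - 1" u] i j unfolding nbs_def by auto
    qed
    moreover have "f v = i" using f[OF _ v(2)] i by auto
    ultimately show "\<exists>v\<in>pverts G. f v = i \<and> (\<forall>j\<in>{1..<i}. \<exists>u. (v, u) \<in> parcs G \<and> f u = j)"
      using v(1) by blast
  qed
  then show ?thesis by (rule partial_grundy_yes_if_witness)
qed

text \<open>This replaces the threshold \<open>k ^ k\<close> by a power of two, which the program
  computes by repeated doubling.\<close>

lemma power_self_le: "k ^ k \<le> (2::nat) ^ k\<^sup>2"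
proof -
  have "k ^ k \<le> (2 ^ k) ^ k" by (rule power_mono) (simp_all add: less_imp_le)
  then show ?thesis by (simp add: power_mult[symmetric] power2_eq_square)
qed

lemma yes_if_many_representatives:
  assumes "R \<subseteq> pverts G" "\<And>x y. x \<in> R \<Longrightarrow> y \<in> R \<Longrightarrow> x \<noteq> y \<Longrightarrow> x \<notin> near G k y" "2 ^ k\<^sup>2 < card R"
  shows "partial_grundy_yes G k"
proof (rule ccontr)
  assume "\<not> ?thesis"
  then have "card R \<le> k ^ k"
    using assms(1,2) by (intro card_separated_le) (auto simp: near_def subset_iff not_le[symmetric])
  then show False using assms(3) power_self_le[of k] by simp
qed

lemma card_Diff_nbs_le: "card (nbs G x - nbs G y) \<le> nb_dist G x y" "card (nbs G y - nbs G x) \<le> nb_dist G x y"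
  unfolding nb_dist_def by (auto intro!: card_mono)

lemma yes_if_many_exceptional:
  assumes "4 * k ^ 6 < card (nbs G r - common G k r)"
  shows "partial_grundy_yes G k"
proof (rule ccontr)
  assume no: "\<not> ?thesis"
  have "card {y \<in> nbs G r. \<exists>x\<in>near G k r. y \<notin> nbs G x} \<le> k ^ 3 * (4 * k ^ 3)"
  proof (rule card_exceptional_le[OF no])
    show "near G k r \<subseteq> pverts G" unfolding near_def by auto
    show "card (nbs G r - nbs G x) \<le> 4 * k ^ 3" if "x \<in> near G k r" for x
      using that card_Diff_nbs_le(2)[of r x] unfolding near_def by auto
  qed
  moreover have "nbs G r - common G k r = {y \<in> nbs G r. \<exists>x\<in>near G k r. y \<notin> nbs G x}"
    unfolding common_def by auto
  moreover have "k ^ 3 * (4 * k ^ 3) = 4 * k ^ 6" by (simp add: power_numeral_reduce)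
  ultimately show False using assms by (metis leD)
qed

text \<open>The bits in \<open>P1\<close> propose a small witness and guess the representatives near
  its vertices; the bits in \<open>P0\<close> suppress everything that could interfere.\<close>

lemma accepting_pattern:
  assumes yes: "partial_grundy_yes G k" and k: "1 \<le> k"
    and R: "R \<subseteq> pverts G" "\<And>v. v \<in> pverts G \<Longrightarrow> \<exists>r\<in>R. v \<in> near G k r" "card R \<le> 2 ^ k\<^sup>2"
    and exc: "\<And>r. r \<in> R \<Longrightarrow> card (nbs G r - common G k r) \<le> 4 * k ^ 6"
  obtains P1 P0 where "P1 \<subseteq> pverts G \<times> {..<2 * k}" "P0 \<subseteq> pverts G \<times> {..<2 * k}" "P1 \<inter> P0 = {}"
    "card P1 \<le> 2 * k\<^sup>2" "2 * card P0 \<le> 2 ^ (14 * k\<^sup>2)"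
    "\<And>D. P1 \<subseteq> D \<Longrightarrow> P0 \<inter> D = {} \<Longrightarrow> accepts G k R D"
proof -
  obtain f where f: "grundy_witness G k f" and cardW: "card {v \<in> pverts G. f v \<noteq> 0} \<le> k\<^sup>2"
    using small_witness_if_partial_grundy_yes[OF yes] .
  define W where "W = {v \<in> pverts G. f v \<noteq> 0}"
  have finW: "finite W" unfolding W_def by simp
  have finR: "finite R" using R(1) finite_subset by fastforce
  obtain \<rho> where \<rho>: "\<And>v. v \<in> pverts G \<Longrightarrow> \<rho> v \<in> R \<and> v \<in> near G k (\<rho> v)" using R(2) by metis
  have fpr: "f u \<noteq> f v" if "(u, v) \<in> parcs G" "f u \<noteq> 0" for u v
    using f that unfolding grundy_witness_def by fastforce
  have fk: "f v \<le> k" if "v \<in> pverts G" for v using f that unfolding grundy_witness_def by blast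
  define P1 where "P1 = (\<lambda>x. (x, f x - 1)) ` W \<union> (\<lambda>x. (\<rho> x, k + (f x - 1))) ` W"
  \<comment> \<open>These are the proposals to neighbors of \<open>x\<close> that the guess at
    \<open>\<rho> x\<close> does not discard.\<close>
  define X where "X x = (nbs G x - common G k (\<rho> x)) \<times> {f x - 1}" for x
  \<comment> \<open>Outside \<open>P1\<close> these bits must be 0: all guesses at representatives,
    the conflicting proposals in the sets \<open>X x\<close>, and all proposals to vertices of the
    witness.\<close>
  define P where "P = R \<times> {k..<2 * k} \<union> (\<Union>x\<in>W. X x) \<union> W \<times> {..<k}"
  have Wk: "f x - 1 < k" if "x \<in> W" for x using that fk[of x] k unfolding W_def by auto
  have "P1 \<subseteq> pverts G \<times> {..<2 * k}"
    using \<rho> R(1) Wk unfolding P1_def W_def by fastforce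
  moreover have PV: "P \<subseteq> pverts G \<times> {..<2 * k}"
    using R(1) Wk nbs_subset unfolding P_def X_def W_def by fastforce
  moreover have "card P1 \<le> 2 * k\<^sup>2"
  proof -
    have "card P1 \<le> card ((\<lambda>x. (x, f x - 1)) ` W) + card ((\<lambda>x. (\<rho> x, k + (f x - 1))) ` W)"
      unfolding P1_def by (rule card_Un_le)
    also have "\<dots> \<le> card W + card W" by (intro add_mono card_image_le finW)
    finally show ?thesis using cardW unfolding W_def by simp
  qed
  moreover have "2 * card (P - P1) \<le> 2 ^ (14 * k\<^sup>2)"
  proof -
    have X: "card (X x) \<le> 4 * k ^ 3 + 4 * k ^ 6" if "x \<in> W" for x
    proof -
      have x: "\<rho> x \<in> R" "nb_dist G x (\<rho> x) \<le> 4 * k ^ 3" using \<rho>[of x] that unfolding W_def near_def by auto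
      \<comment> \<open>A neighbor of \<open>x\<close> outside \<open>common\<close> either is no
        neighbor of \<open>\<rho> x\<close>, or is an exceptional neighbor of
        \<open>\<rho> x\<close>.\<close>
      have "nbs G x - common G k (\<rho> x) \<subseteq> (nbs G x - nbs G (\<rho> x)) \<union> (nbs G (\<rho> x) - common G k (\<rho> x))" by blast
      then have "card (nbs G x - common G k (\<rho> x)) \<le>
          card ((nbs G x - nbs G (\<rho> x)) \<union> (nbs G (\<rho> x) - common G k (\<rho> x)))"
        by (intro card_mono) auto
      also have "\<dots> \<le> card (nbs G x - nbs G (\<rho> x)) + card (nbs G (\<rho> x) - common G k (\<rho> x))"
        by (rule card_Un_le)
      also have "\<dots> \<le> 4 * k ^ 3 + 4 * k ^ 6"
        using card_Diff_nbs_le(1)[of x "\<rho> x"] x exc[OF x(1)] by simp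
      finally show ?thesis unfolding X_def by simp
    qed
    \<comment> \<open>Since \<open>k \<le> z\<close>, the count is at most
      \<open>10 * z ^ 8 \<le> z ^ 12\<close>; the factor 2 costs at most \<open>z^2\<close>, which
      gives the exponent 14.\<close>
    define z :: nat where "z = 2 ^ k\<^sup>2"
    have "card (\<Union>x\<in>W. X x) \<le> (\<Sum>x\<in>W. card (X x))" by (rule card_UN_le[OF finW])
    also have "\<dots> \<le> (\<Sum>x\<in>W. 4 * k ^ 3 + 4 * k ^ 6)" by (rule sum_mono) (rule X)
    also have "\<dots> \<le> k\<^sup>2 * (4 * k ^ 3 + 4 * k ^ 6)" using cardW unfolding W_def by simp
    finally have UX: "card (\<Union>x\<in>W. X x) \<le> k\<^sup>2 * (4 * k ^ 3 + 4 * k ^ 6)" .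
    have "card (P - P1) \<le> card P"
      using PV by (intro card_mono) (auto intro: finite_subset)
    also have "\<dots> \<le> card (R \<times> {k..<2 * k}) + card (\<Union>x\<in>W. X x) + card (W \<times> {..<k})"
      unfolding P_def by (meson add_mono_thms_linordered_semiring(3) card_Un_le order_trans)
    also have "\<dots> \<le> z * k + k\<^sup>2 * (4 * k ^ 3 + 4 * k ^ 6) + k\<^sup>2 * k"
      using R(3) UX cardW unfolding W_def z_def by (intro add_mono) (auto simp: card_cartesian_product)
    also have "\<dots> \<le> z * z + z\<^sup>2 * (4 * z ^ 3 + 4 * z ^ 6) + z\<^sup>2 * z"
    proof -
      have "k \<le> k\<^sup>2" by (simp add: power2_eq_square)
      also have "\<dots> \<le> z" unfolding z_def by (simp add: less_imp_le)
      finally have "k \<le> z" .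
      then show ?thesis by (intro add_mono mult_mono power_mono) auto
    qed
    also have "\<dots> = z ^ 2 + 4 * z ^ 5 + 4 * z ^ 8 + z ^ 3" by (simp add: algebra_simps power_numeral_reduce)
    also have "\<dots> \<le> z ^ 8 + 4 * z ^ 8 + 4 * z ^ 8 + z ^ 8"
      by (intro add_mono mult_left_mono power_increasing) (auto simp: z_def)
    also have "\<dots> \<le> z ^ 4 * z ^ 8"
    proof -
      have "2 \<le> z" using k power_increasing[of 1 "k\<^sup>2" "2::nat"] unfolding z_def by simp
      then have "2 ^ 4 \<le> z ^ 4" by (rule power_mono) simp
      then have "10 * z ^ 8 \<le> z ^ 4 * z ^ 8" by (intro mult_le_mono1) simp
      then show ?thesis by linarith
    qed
    finally have "2 * card (P - P1) \<le> 2 * (z ^ 4 * z ^ 8)" by simp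
    also have "\<dots> \<le> z\<^sup>2 * (z ^ 4 * z ^ 8)"
    proof -
      have "2 \<le> z" using k power_increasing[of 1 "k\<^sup>2" "2::nat"] unfolding z_def by simp
      then have "2 \<le> z\<^sup>2" using self_le_power[of z 2] by simp
      then show ?thesis by (rule mult_le_mono1)
    qed
    also have "\<dots> = 2 ^ (14 * k\<^sup>2)" unfolding z_def by (simp add: power_mult[symmetric] power_add[symmetric])
    finally show ?thesis .
  qed
  moreover have "accepts G k R D" if D1: "P1 \<subseteq> D" and D0: "(P - P1) \<inter> D = {}" for D
  proof -
    have out: "(v, j) \<notin> D" if "(v, j) \<in> P" "(v, j) \<notin> P1" for v j using D0 that by blast
    have col: "colored G k R D x (f x - 1)" if x: "x \<in> W" for x
      unfolding colored_def
    proof (intro conjI ballI allI impI)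
      show "survives G k R D x (f x - 1)"
        unfolding survives_def
      proof (intro conjI ballI impI)
        show "(x, f x - 1) \<in> D" using D1 x unfolding P1_def by blast
        fix r assume r: "r \<in> R" "(r, k + (f x - 1)) \<in> D"
        \<comment> \<open>A guess that is set belongs to \<open>P1\<close>, so it stems from a
          vertex \<open>x'\<close> near \<open>r\<close> with the color of \<open>x\<close>. If
          \<open>x\<close> were in \<open>common G k r\<close>, then \<open>x'\<close> and
          \<open>x\<close> would be adjacent.\<close>
        have "(r, k + (f x - 1)) \<in> P" using r(1) Wk[OF x] unfolding P_def by auto
        then have "(r, k + (f x - 1)) \<in> P1" using out r(2) by blast
        then have "\<exists>x'\<in>W. r = \<rho> x' \<and> f x' - 1 = f x - 1" unfolding P1_def by (auto dest: Wk)
        then obtain x' where x': "x' \<in> W" "r = \<rho> x'" "f x' - 1 = f x - 1" by blast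
        then have "f x' = f x" using x unfolding W_def by auto
        show "x \<notin> common G k r"
        proof
          assume "x \<in> common G k r"
          then have "(x', x) \<in> parcs G" using \<rho>[of x'] x' unfolding common_def W_def nbs_def by auto
          then show False using fpr[of x' x] \<open>f x' = f x\<close> x' unfolding W_def by auto
        qed
      qed
    next
      \<comment> \<open>The guess at \<open>\<rho> x\<close> discards the common neighbors. For any
        other neighbor the proposal is prescribed to be 0, as it lies in \<open>P1\<close> only for
        a witness vertex with the color of \<open>x\<close>.\<close>
      fix u assume u: "u \<in> nbs G x"
      show "\<not> survives G k R D u (f x - 1)"
      proof (cases "u \<in> common G k (\<rho> x)")
        case True
        moreover have "(\<rho> x, k + (f x - 1)) \<in> D" using D1 x unfolding P1_def by blast
        ultimately show ?thesis using \<rho>[of x] x unfolding survives_def W_def by blast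
      next
        case False
        have "(u, f x - 1) \<notin> P1"
        proof
          assume "(u, f x - 1) \<in> P1"
          then have "u \<in> W" "f u - 1 = f x - 1" using Wk[OF x] unfolding P1_def by auto
          then show False using fpr[of x u] u x unfolding W_def nbs_def by auto
        qed
        moreover have "(u, f x - 1) \<in> P" using False u x unfolding P_def X_def by blast
        ultimately show ?thesis using out unfolding survives_def by blast
      qed
    next
      fix j assume j: "j < k" "j \<noteq> f x - 1"
      then have "(x, j) \<in> P" "(x, j) \<notin> P1" using x unfolding P_def P1_def by auto
      then show "\<not> survives G k R D x j" using out unfolding survives_def by blast
    qed
    show ?thesis
      unfolding accepts_def
    proof (intro allI impI)
      fix i assume i: "i < k"
      then have "Suc i \<in> {1..k}" by simp
      then obtain v where v: "v \<in> pverts G" "f v = Suc i" "\<forall>j\<in>{1..<Suc i}. \<exists>u. (v, u) \<in> parcs G \<and> f u = j"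
        using f unfolding grundy_witness_def by blast
      have "\<exists>u\<in>nbs G v. colored G k R D u j" if j: "j < i" for j
      proof -
        have "Suc j \<in> {1..<Suc i}" using j by simp
        then obtain u where u: "(v, u) \<in> parcs G" "f u = Suc j" using v(3) by blast
        then have "u \<in> W" using parcsD[OF u(1)] unfolding W_def by simp
        then show ?thesis using col[of u] u unfolding nbs_def by auto
      qed
      moreover have "colored G k R D v i" using col[of v] v unfolding W_def by simp
      ultimately show "\<exists>v\<in>pverts G. colored G k R D v i \<and> (\<forall>j<i. \<exists>u\<in>nbs G v. colored G k R D u j)"
        using v(1) by blast
    qed
  qed
  ultimately show thesis using that[of P1 "P - P1"] by blast
qed

end

section \<open>A program logic for expectations\<close>

text \<open>One equation records both that every outcome of the tosses has halted by time
  \<open>t\<close> and that the final state has distribution \<open>M\<close>.\<close>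

definition runs :: "com \<Rightarrow> ram_state \<Rightarrow> nat \<Rightarrow> ram_state pmf \<Rightarrow> bool" where
  "runs p s t M \<longleftrightarrow> run t p s = map_pmf (Pair SKIP) M"

lemma run_SKIP [simp]: "run t SKIP s = return_pmf (SKIP, s)"
  by (induction t) (auto simp: bind_return_pmf)

lemma run_add: "run (a + b) p s = bind_pmf (run a p s) (\<lambda>(p', s'). run b p' s')"
proof (induction a arbitrary: p s)
  case 0 then show ?case by (simp add: bind_return_pmf)
next
  case (Suc a)
  then show ?case by (simp add: bind_assoc_pmf case_prod_unfold)
qed

lemma runs_mono:
  assumes "runs p s t M" "t \<le> t'"
  shows "runs p s t' M"
proof -
  have "run t' p s = bind_pmf (run t p s) (\<lambda>(p', s'). run (t' - t) p' s')"
    using run_add[of t "t' - t" p s] assms(2) by simp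
  then show ?thesis using assms(1) unfolding runs_def by (simp add: bind_map_pmf map_pmf_def[symmetric])
qed

lemma runs_iff:
  "runs p s t M \<longleftrightarrow> (\<forall>x\<in>set_pmf (run t p s). fst x = SKIP) \<and> M = map_pmf snd (run t p s)"
proof
  assume "runs p s t M"
  then show "(\<forall>x\<in>set_pmf (run t p s). fst x = SKIP) \<and> M = map_pmf snd (run t p s)"
    unfolding runs_def by (auto simp: pmf.map_comp o_def)
next
  assume A: "(\<forall>x\<in>set_pmf (run t p s). fst x = SKIP) \<and> M = map_pmf snd (run t p s)"
  then have "map_pmf (Pair SKIP) M = map_pmf (\<lambda>x. (SKIP, snd x)) (run t p s)"
    by (simp add: pmf.map_comp o_def)
  also have "\<dots> = map_pmf (\<lambda>x. x) (run t p s)"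
    using A by (intro map_pmf_cong) (auto simp: prod_eq_iff)
  finally show "runs p s t M" unfolding runs_def by simp
qed

text \<open>Induction on \<open>t\<close> along the first step of \<open>p\<close>. The extra unit
  pays for dropping the finished \<open>SKIP\<close>; branches that halt early are padded by
  \<open>runs_mono\<close>.\<close>

lemma runs_SEQ:
  assumes "runs p s t M" "\<And>s'. s' \<in> set_pmf M \<Longrightarrow> runs q s' t' (N s')"
  shows "runs (SEQ p q) s (t + t' + 1) (bind_pmf M N)"
  using assms
proof (induction t arbitrary: p s M)
  case 0
  then have "return_pmf (p, s) = map_pmf (Pair SKIP) M" unfolding runs_def by simp
  then have ps: "p = SKIP" "M = return_pmf s"
    using 0 unfolding runs_iff by auto
  then show ?case using 0 unfolding runs_def by (simp add: bind_return_pmf)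
next
  case (Suc t)
  show ?case
  proof (cases "p = SKIP")
    case True
    then have M: "M = return_pmf s" using Suc.prems(1) unfolding runs_iff by simp
    then have "runs q s t' (N s)" using Suc.prems(2)[of s] by simp
    then have "runs q s (Suc t + t') (N s)" by (rule runs_mono) simp
    then show ?thesis using True M unfolding runs_def by (simp add: bind_return_pmf)
  next
    case False
    define M' where "M' x = map_pmf snd (run t (fst x) (snd x))" for x
    have M: "M = bind_pmf (step p s) M'"
      using Suc.prems(1) unfolding runs_iff M'_def by (simp add: map_bind_pmf case_prod_unfold)
    have sub: "runs (SEQ (fst x) q) (snd x) (t + t' + 1) (bind_pmf (M' x) N)" if x: "x \<in> set_pmf (step p s)" for x
    proof (rule Suc.IH)
      show "runs (fst x) (snd x) t (M' x)"
        using Suc.prems(1) x unfolding runs_iff M'_def by (fastforce simp: case_prod_unfold)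
      show "runs q s' t' (N s')" if "s' \<in> set_pmf (M' x)" for s'
        using Suc.prems(2) that x unfolding M by auto
    qed
    have "run (Suc t + t' + 1) (SEQ p q) s =
        bind_pmf (step p s) (\<lambda>x. run (t + t' + 1) (SEQ (fst x) q) (snd x))"
      using False by (simp add: bind_map_pmf case_prod_unfold)
    also have "\<dots> = bind_pmf (step p s) (\<lambda>x. map_pmf (Pair SKIP) (bind_pmf (M' x) N))"
      using sub unfolding runs_def by (intro bind_pmf_cong) auto
    also have "\<dots> = map_pmf (Pair SKIP) (bind_pmf M N)"
      unfolding M by (simp add: map_bind_pmf bind_assoc_pmf)
    finally show ?thesis unfolding runs_def .
  qed
qed

abbreviation exec :: "com \<Rightarrow> ram_state \<Rightarrow> nat \<Rightarrow> ram_state \<Rightarrow> bool" where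
  "exec p s t s' \<equiv> runs p s t (return_pmf s')"

lemma exec_SEQ: "exec p s t s' \<Longrightarrow> exec q s' t' s'' \<Longrightarrow> exec (SEQ p q) s (t + t' + 1) s''"
  using runs_SEQ[of p s t "return_pmf s'" q t' "\<lambda>_. return_pmf s''"] by (simp add: bind_return_pmf)

lemma exec_SET: "exec (SET r c) s 1 (set_reg r c s)"
  and exec_COPY: "exec (COPY r x) s 1 (set_reg r (regs s x) s)"
  and exec_ADD: "exec (ADD r x y) s 1 (set_reg r (regs s x + regs s y) s)"
  and exec_SUB: "exec (SUB r x y) s 1 (set_reg r (regs s x - regs s y) s)"
  and exec_LOAD: "exec (LOAD r a x) s 1 (set_reg r (arrs s a (regs s x)) s)"
  and exec_STORE: "exec (STORE a x y) s 1 (set_arr a (regs s x) (regs s y) s)"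
  by (simp_all add: runs_def bind_return_pmf)

lemma runs_LOOP_step: "regs s r \<noteq> 0 \<Longrightarrow> runs (SEQ p (LOOP r p)) s t M \<Longrightarrow> runs (LOOP r p) s (t + 1) M"
  by (simp add: runs_def bind_return_pmf)

lemma exec_LOOP_end: "regs s r = 0 \<Longrightarrow> exec (LOOP r p) s 1 s"
  by (simp add: runs_def bind_return_pmf)

lemma regs_set_reg [simp]: "regs (set_reg r v s) = (regs s)(r := v)"
  and arrs_set_reg [simp]: "arrs (set_reg r v s) = arrs s"
  and regs_set_arr [simp]: "regs (set_arr a i v s) = regs s"
  and arrs_set_arr [simp]: "arrs (set_arr a i v s) = (arrs s)(a := (arrs s a)(i := v))"
  by (simp_all add: set_reg_def set_arr_def)

text \<open>\<open>f\<close> is a postexpectation and \<open>v\<close> a lower bound for its value before the execution of \<open>p\<close>; such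
  bounds compose along sequences and loops like weakest preconditions.\<close>

definition ert :: "com \<Rightarrow> ram_state \<Rightarrow> nat \<Rightarrow> (ram_state \<Rightarrow> bool) \<Rightarrow> (ram_state \<Rightarrow> real) \<Rightarrow> real \<Rightarrow> bool" where
  "ert p s t R f v \<longleftrightarrow> (\<exists>M. runs p s t M \<and> finite (set_pmf M) \<and> (\<forall>s'\<in>set_pmf M. R s') \<and>
     v \<le> measure_pmf.expectation M f)"

lemma ert_exec: "exec p s t s' \<Longrightarrow> R s' \<Longrightarrow> v \<le> f s' \<Longrightarrow> ert p s t R f v"
  unfolding ert_def by (intro exI[of _ "return_pmf s'"]) auto

lemma ert_mono:
  assumes "ert p s t R f v" "t \<le> t'" "\<And>s'. R s' \<Longrightarrow> R' s'" "\<And>s'. R s' \<Longrightarrow> f s' \<le> f' s'" "v' \<le> v"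
  shows "ert p s t' R' f' v'"
proof -
  obtain M where M: "runs p s t M" "finite (set_pmf M)" "\<forall>s'\<in>set_pmf M. R s'"
     "v \<le> measure_pmf.expectation M f" using assms(1) unfolding ert_def by blast
  have "measure_pmf.expectation M f \<le> measure_pmf.expectation M f'"
    using M(2,3) assms(4) by (intro integral_mono_AE) (auto simp: integrable_measure_pmf_finite AE_measure_pmf_iff)
  then show ?thesis using M runs_mono[OF M(1) assms(2)] assms(3,5) unfolding ert_def by fastforce
qed

text \<open>Turns a bound on the probability of a favorable event into a bound on its contribution
  to the overall success probability.\<close>

lemma ert_affine:
  assumes "ert p s t R f v" "0 \<le> a"
  shows "ert p s t R (\<lambda>s'. a * f s' + b) (a * v + b)"
proof -
  obtain M where M: "runs p s t M" "finite (set_pmf M)" "\<forall>s'\<in>set_pmf M. R s'"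
     "v \<le> measure_pmf.expectation M f" using assms(1) unfolding ert_def by blast
  have "measure_pmf.expectation M (\<lambda>s'. a * f s' + b) = a * measure_pmf.expectation M f + b"
    using M(2) by (simp add: integrable_measure_pmf_finite)
  then show ?thesis using M assms(2) unfolding ert_def by (auto simp: mult_left_mono)
qed

text \<open>The law of total expectation; finite supports settle integrability.\<close>

lemma ert_SEQ:
  assumes "ert p s t R f v" "\<And>s'. R s' \<Longrightarrow> ert q s' t' R' f' (f s')"
  shows "ert (SEQ p q) s (t + t' + 1) R' f' v"
proof -
  obtain M where M: "runs p s t M" "finite (set_pmf M)" "\<forall>s'\<in>set_pmf M. R s'"
     "v \<le> measure_pmf.expectation M f" using assms(1) unfolding ert_def by blast
  have "\<forall>s'\<in>set_pmf M. \<exists>N. runs q s' t' N \<and> finite (set_pmf N) \<and> (\<forall>s''\<in>set_pmf N. R' s'') \<and>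
     f s' \<le> measure_pmf.expectation N f'" using assms(2) M(3) unfolding ert_def by blast
  then obtain N where N: "\<And>s'. s' \<in> set_pmf M \<Longrightarrow> runs q s' t' (N s') \<and> finite (set_pmf (N s')) \<and>
     (\<forall>s''\<in>set_pmf (N s'). R' s'') \<and> f s' \<le> measure_pmf.expectation (N s') f'" by metis
  have "measure_pmf.expectation M f \<le> measure_pmf.expectation M (\<lambda>x. measure_pmf.expectation (N x) f')"
    using M(2) N by (intro integral_mono_AE) (auto simp: integrable_measure_pmf_finite AE_measure_pmf_iff)
  also have "\<dots> = measure_pmf.expectation (bind_pmf M N) f'"
    using M(2) N by (subst pmf_expectation_bind[of "set_pmf M"]) (auto simp: integral_measure_pmf[of "set_pmf M"])
  finally show ?thesis
    using runs_SEQ[OF M(1), of q t' N] N M unfolding ert_def by (intro exI[of _ "bind_pmf M N"]) auto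
qed

lemma ert_SEQ_exec:
  assumes "exec p s t s'" "ert q s' t' R f v"
  shows "ert (SEQ p q) s (t + t' + 1) R f v"
  using ert_SEQ[OF ert_exec[OF assms(1), of "\<lambda>x. x = s'" v "\<lambda>_. v"]] assms(2) by auto

lemma ert_FLIP:
  assumes "R (set_reg r 1 s)" "R (set_reg r 0 s)" "v \<le> (f (set_reg r 1 s) + f (set_reg r 0 s)) / 2"
  shows "ert (FLIP r) s 1 R f v"
  unfolding ert_def
proof (intro exI conjI)
  let ?M = "map_pmf (\<lambda>b. set_reg r (if b then 1 else 0) s) (bernoulli_pmf (1 / 2))"
  show "runs (FLIP r) s 1 ?M" by (simp add: runs_def bind_return_pmf bind_map_pmf map_pmf_def bind_assoc_pmf)
  show "finite (set_pmf ?M)" by simp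
  show "\<forall>s'\<in>set_pmf ?M. R s'" using assms(1,2) by auto
  show "v \<le> measure_pmf.expectation ?M f"
    using assms(3) by (simp add: integral_bernoulli_pmf field_simps)
qed

text \<open>A \<open>LOOP\<close> only tests for nonzero, so \<open>q\<close> counts down while
  \<open>x\<close> counts up; \<open>u\<close> holds the constant 1.\<close>

definition FOR :: "nat \<Rightarrow> nat \<Rightarrow> nat \<Rightarrow> nat \<Rightarrow> com \<Rightarrow> com" where
  "FOR u x y q p = SEQ (SET x 0) (SEQ (COPY q y) (LOOP q (SEQ p (SEQ (ADD x x u) (SUB q q u)))))"

text \<open>Here \<open>f i\<close> is the expectation guaranteed before round \<open>i\<close>; the
  induction is on the number \<open>j\<close> of rounds left. \<open>Inv\<close> and
  \<open>f\<close> have to ignore \<open>x\<close> and \<open>q\<close>, which the loop itself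
  changes. Each round costs 6 extra units for updates, sequencing and the test.\<close>

lemma ert_FOR:
  assumes dist: "x \<noteq> q" "x \<noteq> u" "q \<noteq> u" "y \<noteq> x"
    and u: "regs s u = 1" and y: "regs s y = m" and Inv0: "Inv 0 s"
    and Inv: "\<And>i a s. Inv i (set_reg x a s) = Inv i s" "\<And>i a s. Inv i (set_reg q a s) = Inv i s"
    and f: "\<And>i a s. f i (set_reg x a s) = f i s" "\<And>i a s. f i (set_reg q a s) = f i s"
    and body: "\<And>i s. i < m \<Longrightarrow> Inv i s \<Longrightarrow> regs s x = i \<Longrightarrow> regs s u = 1 \<Longrightarrow>
      ert p s t (\<lambda>s'. Inv (Suc i) s' \<and> regs s' x = regs s x \<and> regs s' q = regs s q \<and> regs s' u = 1)
        (f (Suc i)) (f i s)"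
  shows "ert (FOR u x y q p) s (m * (t + 6) + 5) (\<lambda>s'. Inv m s' \<and> regs s' u = 1) (f m) (f 0 s)"
proof -
  define L where "L = LOOP q (SEQ p (SEQ (ADD x x u) (SUB q q u)))"
  have loop: "ert L s (j * (t + 6) + 1) (\<lambda>s'. Inv m s' \<and> regs s' u = 1) (f m) (f (m - j) s)"
    if "j \<le> m" "Inv (m - j) s" "regs s x = m - j" "regs s q = j" "regs s u = 1" for j s
    using that
  proof (induction j arbitrary: s)
    case 0
    then have "exec L s 1 s" unfolding L_def by (intro exec_LOOP_end) simp
    then show ?case using 0 by (intro ert_exec[where s' = s]) auto
  next
    case (Suc j)
    have mj: "Suc (m - Suc j) = m - j" using Suc.prems(1) by simp
    have "ert (SEQ (SEQ p (SEQ (ADD x x u) (SUB q q u))) L) s ((t + (1 + 1 + 1) + 1) + (j * (t + 6) + 1) + 1)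
        (\<lambda>s'. Inv m s' \<and> regs s' u = 1) (f m) (f (m - Suc j) s)"
    proof (rule ert_SEQ[where f = "f (m - j)"])
      show "ert (SEQ p (SEQ (ADD x x u) (SUB q q u))) s (t + (1 + 1 + 1) + 1)
         (\<lambda>s'. Inv (m - j) s' \<and> regs s' x = m - j \<and> regs s' q = j \<and> regs s' u = 1)
         (f (m - j)) (f (m - Suc j) s)"
      proof (rule ert_SEQ)
        show "ert p s t (\<lambda>s'. Inv (Suc (m - Suc j)) s' \<and> regs s' x = regs s x \<and> regs s' q = regs s q \<and> regs s' u = 1)
          (f (Suc (m - Suc j))) (f (m - Suc j) s)"
          using Suc.prems by (intro body) auto
        fix s' assume s': "Inv (Suc (m - Suc j)) s' \<and> regs s' x = regs s x \<and> regs s' q = regs s q \<and> regs s' u = 1"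
        show "ert (SEQ (ADD x x u) (SUB q q u)) s' (1 + 1 + 1)
           (\<lambda>s'. Inv (m - j) s' \<and> regs s' x = m - j \<and> regs s' q = j \<and> regs s' u = 1)
           (f (m - j)) (f (Suc (m - Suc j)) s')"
          using s' Suc.prems dist mj by (intro ert_exec[OF exec_SEQ[OF exec_ADD exec_SUB]]) (auto simp: Inv f)
      qed
      fix s' assume "Inv (m - j) s' \<and> regs s' x = m - j \<and> regs s' q = j \<and> regs s' u = 1"
      then show "ert L s' (j * (t + 6) + 1) (\<lambda>s'. Inv m s' \<and> regs s' u = 1) (f m) (f (m - j) s')"
        using Suc.prems(1) by (intro Suc.IH) auto
    qed
    then obtain M where M: "runs (SEQ (SEQ p (SEQ (ADD x x u) (SUB q q u))) L) s ((t + (1 + 1 + 1) + 1) + (j * (t + 6) + 1) + 1) M"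
      "finite (set_pmf M)" "\<forall>s'\<in>set_pmf M. Inv m s' \<and> regs s' u = 1"
      "f (m - Suc j) s \<le> measure_pmf.expectation M (f m)" unfolding ert_def by blast
    have "runs L s (((t + (1 + 1 + 1) + 1) + (j * (t + 6) + 1) + 1) + 1) M"
      unfolding L_def using Suc.prems M(1) by (intro runs_LOOP_step) (auto simp: L_def)
    then have "runs L s (Suc j * (t + 6) + 1) M" by (rule runs_mono) simp
    then show ?case using M unfolding ert_def by blast
  qed
  have "ert (FOR u x y q p) s (1 + (1 + (m * (t + 6) + 1) + 1) + 1) (\<lambda>s'. Inv m s' \<and> regs s' u = 1) (f m)
      (f 0 (set_reg q m (set_reg x 0 s)))"
    unfolding FOR_def L_def[symmetric]
  proof (rule ert_SEQ_exec[OF exec_SET], rule ert_SEQ_exec[OF exec_COPY])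
    show "ert L (set_reg q (regs (set_reg x 0 s) y) (set_reg x 0 s)) (m * (t + 6) + 1)
     (\<lambda>s'. Inv m s' \<and> regs s' u = 1) (f m) (f 0 (set_reg q m (set_reg x 0 s)))"
      using loop[of m "set_reg q m (set_reg x 0 s)"] dist u y Inv0 by (simp add: Inv)
  qed
  then show ?thesis by (rule ert_mono) (auto simp: f)
qed


section \<open>Arithmetic expressions with bounded sums and their compilation\<close>

datatype aexp =
    Num nat
  | Var nat
  | Plus aexp aexp
  | Minus aexp aexp
  | Cell nat aexp
  | Sum nat nat aexp

primrec aval :: "aexp \<Rightarrow> (nat \<Rightarrow> nat) \<Rightarrow> (nat \<Rightarrow> nat \<Rightarrow> nat) \<Rightarrow> nat" where
  "aval (Num c) \<rho> \<alpha> = c"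
| "aval (Var x) \<rho> \<alpha> = \<rho> x"
| "aval (Plus d e) \<rho> \<alpha> = aval d \<rho> \<alpha> + aval e \<rho> \<alpha>"
| "aval (Minus d e) \<rho> \<alpha> = aval d \<rho> \<alpha> - aval e \<rho> \<alpha>"
| "aval (Cell b e) \<rho> \<alpha> = \<alpha> b (aval e \<rho> \<alpha>)"
| "aval (Sum x y e) \<rho> \<alpha> = (\<Sum>i<\<rho> y. aval e (\<rho>(x := i)) \<alpha>)"

text \<open>The registers whose initial values bound the summation ranges, and hence the running time.\<close>

primrec bnds :: "aexp \<Rightarrow> nat set" where
  "bnds (Num c) = {}"
| "bnds (Var x) = {}"
| "bnds (Plus d e) = bnds d \<union> bnds e"
| "bnds (Minus d e) = bnds d \<union> bnds e"
| "bnds (Cell b e) = bnds e"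
| "bnds (Sum x y e) = insert y (bnds e - {x})"

primrec wf_exp :: "nat \<Rightarrow> aexp \<Rightarrow> bool" where
  "wf_exp r (Num c) = True"
| "wf_exp r (Var x) = (x < r)"
| "wf_exp r (Plus d e) = (wf_exp r d \<and> wf_exp r e)"
| "wf_exp r (Minus d e) = (wf_exp r d \<and> wf_exp r e)"
| "wf_exp r (Cell b e) = wf_exp r e"
| "wf_exp r (Sum x y e) = (x < r \<and> y < r \<and> wf_exp r e)"

text \<open>The value is left in register \<open>r\<close>; the registers below \<open>r\<close> keep their values.\<close>

primrec compile :: "aexp \<Rightarrow> nat \<Rightarrow> com" where
  "compile (Num c) r = SET r c"
| "compile (Var x) r = COPY r x"
| "compile (Plus d e) r = SEQ (SEQ (compile d r) (compile e (r + 1))) (ADD r r (r + 1))"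
| "compile (Minus d e) r = SEQ (SEQ (compile d r) (compile e (r + 1))) (SUB r r (r + 1))"
| "compile (Cell b e) r = SEQ (compile e r) (LOAD r b r)"
| "compile (Sum x y e) r =
     SEQ (COPY r y) (SEQ (SET (r + 1) 0) (SEQ (COPY (r + 2) x) (SEQ (SET (r + 3) 1) (SEQ (SET x 0)
       (SEQ (LOOP r (SEQ (compile e (r + 4))
           (SEQ (ADD (r + 1) (r + 1) (r + 4)) (SEQ (ADD x x (r + 3)) (SUB r r (r + 3))))))
         (SEQ (COPY r (r + 1)) (COPY x (r + 2))))))))"

primrec cost :: "aexp \<Rightarrow> nat \<Rightarrow> nat" where
  "cost (Num c) B = 1"
| "cost (Var x) B = 1"
| "cost (Plus d e) B = cost d B + cost e B + 3"
| "cost (Minus d e) B = cost d B + cost e B + 3"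
| "cost (Cell b e) B = cost e B + 2"
| "cost (Sum x y e) B = B * (cost e B + 8) + 20"

lemma wf_exp_mono: "wf_exp r e \<Longrightarrow> r \<le> r' \<Longrightarrow> wf_exp r' e"
  by (induction e) auto

lemma bnds_less: "wf_exp r e \<Longrightarrow> y \<in> bnds e \<Longrightarrow> y < r"
  by (induction e) auto

lemma aval_cong:
  "wf_exp r e \<Longrightarrow> (\<And>z. z < r \<Longrightarrow> \<rho> z = \<rho>' z) \<Longrightarrow> aval e \<rho> \<alpha> = aval e \<rho>' \<alpha>"
proof (induction e arbitrary: \<rho> \<rho>')
  case (Plus d e)
  show ?case using Plus.prems Plus.IH(1)[of \<rho> \<rho>'] Plus.IH(2)[of \<rho> \<rho>'] by simp
next
  case (Minus d e)
  show ?case using Minus.prems Minus.IH(1)[of \<rho> \<rho>'] Minus.IH(2)[of \<rho> \<rho>'] by simp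
next
  case (Cell b e)
  show ?case using Cell.prems Cell.IH[of \<rho> \<rho>'] by simp
next
  case (Sum x y e)
  have "aval e (\<rho>(x := i)) \<alpha> = aval e (\<rho>'(x := i)) \<alpha>" for i
    using Sum.prems by (intro Sum.IH) auto
  moreover have "\<rho> y = \<rho>' y" using Sum.prems by simp
  ultimately show ?case by simp
qed auto

text \<open>By \<open>wf_exp r e\<close> all registers of \<open>e\<close> lie below
  \<open>r\<close>, so scratch space from \<open>r\<close> on cannot disturb them; a subexpression
  is compiled above the scratch registers still in use.\<close>

lemma compile_correct:
  assumes "wf_exp r e" "\<And>y. y \<in> bnds e \<Longrightarrow> regs s y \<le> B"
  shows "\<exists>s'. exec (compile e r) s (cost e B) s' \<and> arrs s' = arrs s \<and>
    regs s' r = aval e (regs s) (arrs s) \<and> (\<forall>z<r. regs s' z = regs s z)"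
  using assms
proof (induction e arbitrary: r s)
  case (Num c)
  then show ?case using exec_SET[of r c s] by (intro exI[of _ "set_reg r c s"]) auto
next
  case (Var x)
  then show ?case using exec_COPY[of r x s] by (intro exI[of _ "set_reg r (regs s x) s"]) auto
next
  case (Plus d e)
  obtain s1 where s1: "exec (compile d r) s (cost d B) s1" "arrs s1 = arrs s"
    "regs s1 r = aval d (regs s) (arrs s)" "\<forall>z<r. regs s1 z = regs s z"
    using Plus.IH(1)[of r s] Plus.prems by auto
  have "wf_exp (r + 1) e" using Plus.prems wf_exp_mono[of r e "r + 1"] by simp
  moreover have "regs s1 y \<le> B" if "y \<in> bnds e" for y
    using Plus.prems that bnds_less[of r e y] s1(4) by auto
  ultimately obtain s2 where s2: "exec (compile e (r + 1)) s1 (cost e B) s2" "arrs s2 = arrs s1"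
    "regs s2 (r + 1) = aval e (regs s1) (arrs s1)" "\<forall>z<r + 1. regs s2 z = regs s1 z"
    using Plus.IH(2)[of "r + 1" s1] by auto
  have "aval e (regs s1) (arrs s1) = aval e (regs s) (arrs s)"
    using aval_cong[of r e "regs s1" "regs s"] Plus.prems s1 by simp
  moreover have "exec (compile (Plus d e) r) s (cost (Plus d e) B) (set_reg r (regs s2 r + regs s2 (r + 1)) s2)"
    using exec_SEQ[OF exec_SEQ[OF s1(1) s2(1)] exec_ADD[of r r "r + 1"]] by (simp add: add.assoc numeral_3_eq_3)
  ultimately show ?case using s1(2-4) s2(2-4) by (intro exI[of _ "set_reg r (regs s2 r + regs s2 (r + 1)) s2"]) auto
next
  case (Minus d e)
  obtain s1 where s1: "exec (compile d r) s (cost d B) s1" "arrs s1 = arrs s"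
    "regs s1 r = aval d (regs s) (arrs s)" "\<forall>z<r. regs s1 z = regs s z"
    using Minus.IH(1)[of r s] Minus.prems by auto
  have "wf_exp (r + 1) e" using Minus.prems wf_exp_mono[of r e "r + 1"] by simp
  moreover have "regs s1 y \<le> B" if "y \<in> bnds e" for y
    using Minus.prems that bnds_less[of r e y] s1(4) by auto
  ultimately obtain s2 where s2: "exec (compile e (r + 1)) s1 (cost e B) s2" "arrs s2 = arrs s1"
    "regs s2 (r + 1) = aval e (regs s1) (arrs s1)" "\<forall>z<r + 1. regs s2 z = regs s1 z"
    using Minus.IH(2)[of "r + 1" s1] by auto
  have "aval e (regs s1) (arrs s1) = aval e (regs s) (arrs s)"
    using aval_cong[of r e "regs s1" "regs s"] Minus.prems s1 by simp
  moreover have "exec (compile (Minus d e) r) s (cost (Minus d e) B) (set_reg r (regs s2 r - regs s2 (r + 1)) s2)"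
    using exec_SEQ[OF exec_SEQ[OF s1(1) s2(1)] exec_SUB[of r r "r + 1"]] by (simp add: add.assoc numeral_3_eq_3)
  ultimately show ?case using s1(2-4) s2(2-4) by (intro exI[of _ "set_reg r (regs s2 r - regs s2 (r + 1)) s2"]) auto
next
  case (Cell b e)
  obtain s1 where s1: "exec (compile e r) s (cost e B) s1" "arrs s1 = arrs s"
    "regs s1 r = aval e (regs s) (arrs s)" "\<forall>z<r. regs s1 z = regs s z"
    using Cell.IH[of r s] Cell.prems by auto
  then show ?case using exec_SEQ[OF s1(1) exec_LOAD[of r b r]]
    by (intro exI[of _ "set_reg r (arrs s1 b (regs s1 r)) s1"]) auto
next
  case (Sum x y e)
  define m where "m = regs s y"
  define F where "F i = (\<Sum>j<i. aval e ((regs s)(x := j)) (arrs s))" for i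
  have vars: "x < r" "y < r" "wf_exp r e" using Sum.prems by auto
  have mB: "m \<le> B" using Sum.prems unfolding m_def by simp
  define body where "body = SEQ (compile e (r + 4))
    (SEQ (ADD (r + 1) (r + 1) (r + 4)) (SEQ (ADD x x (r + 3)) (SUB r r (r + 3))))"
  \<comment> \<open>In the loop for a sum, \<open>r\<close> counts down, \<open>r + 1\<close>
    accumulates, \<open>r + 2\<close> saves the old value of the bound register \<open>x\<close>,
    and \<open>r + 3\<close> holds 1.\<close>
  define St where "St i s' \<longleftrightarrow> arrs s' = arrs s \<and> regs s' x = i \<and> regs s' (r + 1) = F i \<and> regs s' r = m - i \<and>
    regs s' (r + 2) = regs s x \<and> regs s' (r + 3) = 1 \<and>
    (\<forall>z<r. z \<noteq> x \<longrightarrow> regs s' z = regs s z)" for i and s' :: ram_state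
  have body: "\<exists>s''. exec body s' (cost e B + 6) s'' \<and> St (Suc i) s''" if St: "St i s'" and i: "i < m" for i s'
  proof -
    \<comment> \<open>If \<open>z = x\<close>, an inner sum runs up to the current outer index,
      which is below \<open>m \<le> B\<close>.\<close>
    have "regs s' z \<le> B" if z: "z \<in> bnds e" for z
    proof (cases "z = x")
      case True then show ?thesis using St i mB unfolding St_def by simp
    next
      case False
      then have "regs s' z = regs s z" using St bnds_less[OF vars(3) z] unfolding St_def by auto
      then show ?thesis using Sum.prems(2)[of z] z False by simp
    qed
    moreover have "wf_exp (r + 4) e" using vars(3) wf_exp_mono by force
    ultimately obtain s1 where s1: "exec (compile e (r + 4)) s' (cost e B) s1" "arrs s1 = arrs s'"
      "regs s1 (r + 4) = aval e (regs s') (arrs s')" "\<forall>z<r + 4. regs s1 z = regs s' z"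
      using Sum.IH[of "r + 4" s'] by auto
    have "aval e (regs s') (arrs s') = aval e ((regs s)(x := i)) (arrs s)"
      using St aval_cong[OF vars(3), of "regs s'" "(regs s)(x := i)"] unfolding St_def by auto
    then have v: "F i + regs s1 (r + 4) = F (Suc i)" using s1(3) unfolding F_def by simp
    define s2 where "s2 = set_reg (r + 1) (regs s1 (r + 1) + regs s1 (r + 4)) s1"
    define s3 where "s3 = set_reg x (regs s2 x + regs s2 (r + 3)) s2"
    define s4 where "s4 = set_reg r (regs s3 r - regs s3 (r + 3)) s3"
    have "exec body s' (cost e B + (1 + (1 + 1 + 1) + 1) + 1) s4"
      unfolding body_def s4_def s3_def s2_def
      by (intro exec_SEQ[OF s1(1)] exec_SEQ[OF exec_ADD] exec_SUB)
    then have "exec body s' (cost e B + 6) s4" by (rule runs_mono) simp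
    moreover have "St (Suc i) s4"
      using St s1 v vars(1,2) i unfolding St_def s4_def s3_def s2_def by auto
    ultimately show ?thesis by blast
  qed
  have loop: "\<exists>s''. exec (LOOP r body) s' (j * (cost e B + 8) + 1) s'' \<and> St m s''"
    if "St (m - j) s'" "j \<le> m" for j s'
    using that
  proof (induction j arbitrary: s')
    case 0
    then have "regs s' r = 0" unfolding St_def by simp
    then show ?case using exec_LOOP_end[of s' r body] 0 by auto
  next
    case (Suc j)
    obtain s1 where s1: "exec body s' (cost e B + 6) s1" "St (Suc (m - Suc j)) s1"
      using body[OF Suc.prems(1)] Suc.prems(2) by auto
    obtain s2 where s2: "exec (LOOP r body) s1 (j * (cost e B + 8) + 1) s2" "St m s2"
      using Suc.IH[of s1] s1(2) Suc.prems(2) by (metis Suc_diff_Suc Suc_leD Suc_le_lessD)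
    have "regs s' r \<noteq> 0" using Suc.prems unfolding St_def by simp
    then have "exec (LOOP r body) s' ((cost e B + 6) + (j * (cost e B + 8) + 1) + 1 + 1) s2"
      using exec_SEQ[OF s1(1) s2(1)] by (rule runs_LOOP_step)
    then have "exec (LOOP r body) s' (Suc j * (cost e B + 8) + 1) s2" by (rule runs_mono) simp
    then show ?case using s2(2) by blast
  qed
  define t1 where "t1 = set_reg r (regs s y) s"
  define t2 where "t2 = set_reg (r + 1) 0 t1"
  define t3 where "t3 = set_reg (r + 2) (regs t2 x) t2"
  define t4 where "t4 = set_reg (r + 3) 1 t3"
  define t5 where "t5 = set_reg x 0 t4"
  have "St (m - m) t5"
    using vars(1,2) unfolding St_def t5_def t4_def t3_def t2_def t1_def m_def by (auto simp: F_def)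
  then obtain t6 where t6: "exec (LOOP r body) t5 (m * (cost e B + 8) + 1) t6" "St m t6"
    using loop[of m t5] by auto
  define t7 where "t7 = set_reg r (regs t6 (r + 1)) t6"
  define t8 where "t8 = set_reg x (regs t7 (r + 2)) t7"
  have "exec (compile (Sum x y e) r) s
     (1 + (1 + (1 + (1 + (1 + ((m * (cost e B + 8) + 1) + (1 + 1 + 1) + 1) + 1) + 1) + 1) + 1) + 1) t8"
    unfolding compile.simps body_def[symmetric] t8_def t7_def
    by (rule exec_SEQ[OF exec_COPY], fold t1_def, rule exec_SEQ[OF exec_SET], fold t2_def,
        rule exec_SEQ[OF exec_COPY], fold t3_def, rule exec_SEQ[OF exec_SET], fold t4_def,
        rule exec_SEQ[OF exec_SET], fold t5_def, rule exec_SEQ[OF t6(1)],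
        rule exec_SEQ[OF exec_COPY], rule exec_COPY)
  moreover have "m * (cost e B + 8) \<le> B * (cost e B + 8)" using mB by (rule mult_le_mono1)
  ultimately have "exec (compile (Sum x y e) r) s (cost (Sum x y e) B) t8"
    unfolding cost.simps by (elim runs_mono) linarith
  moreover have "arrs t8 = arrs s" "regs t8 r = F m" "\<forall>z<r. regs t8 z = regs s z"
    using t6(2) vars(1,2) unfolding St_def t8_def t7_def by auto
  ultimately show ?case unfolding F_def m_def by auto
qed

section \<open>Polynomial growth\<close>

definition poly_bounded :: "(nat \<Rightarrow> nat) \<Rightarrow> bool" where
  "poly_bounded g \<longleftrightarrow> (\<exists>c. \<forall>B\<ge>2. g B \<le> B ^ c)"

text \<open>From \<open>B = 2\<close> on, a pure power of \<open>B\<close> absorbs constants, so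
  bounds of the form \<open>B ^ c\<close> need no coefficients.\<close>

lemma poly_bounded_const: "poly_bounded (\<lambda>_. c)"
  unfolding poly_bounded_def
proof (intro exI allI impI)
  fix B :: nat assume "2 \<le> B"
  have "c \<le> 2 ^ c" by (simp add: less_imp_le)
  also have "\<dots> \<le> B ^ c" using \<open>2 \<le> B\<close> by (rule power_mono) simp
  finally show "c \<le> B ^ c" .
qed

lemma poly_bounded_id: "poly_bounded (\<lambda>B. B)"
  unfolding poly_bounded_def by (intro exI[of _ 1]) simp

lemma poly_bounded_add:
  assumes "poly_bounded g" "poly_bounded h"
  shows "poly_bounded (\<lambda>B. g B + h B)"
proof -
  obtain a b where ab: "\<And>B. 2 \<le> B \<Longrightarrow> g B \<le> B ^ a" "\<And>B. 2 \<le> B \<Longrightarrow> h B \<le> B ^ b"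
    using assms unfolding poly_bounded_def by blast
  have "g B + h B \<le> B ^ (a + b + 1)" if B: "2 \<le> B" for B
  proof -
    have "B ^ a \<le> B ^ (a + b)" "B ^ b \<le> B ^ (a + b)" using B by (auto intro!: power_increasing)
    then have "g B + h B \<le> 2 * B ^ (a + b)" using ab[OF B] by linarith
    also have "\<dots> \<le> B * B ^ (a + b)" using B by simp
    finally show ?thesis by simp
  qed
  then show ?thesis unfolding poly_bounded_def by blast
qed

lemma poly_bounded_mult:
  assumes "poly_bounded g" "poly_bounded h"
  shows "poly_bounded (\<lambda>B. g B * h B)"
proof -
  obtain a b where ab: "\<And>B. 2 \<le> B \<Longrightarrow> g B \<le> B ^ a" "\<And>B. 2 \<le> B \<Longrightarrow> h B \<le> B ^ b"
    using assms unfolding poly_bounded_def by blast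
  have "g B * h B \<le> B ^ (a + b)" if "2 \<le> B" for B
    using mult_le_mono[OF ab(1)[OF that] ab(2)[OF that]] by (simp add: power_add)
  then show ?thesis unfolding poly_bounded_def by blast
qed

lemma poly_bounded_power: "poly_bounded g \<Longrightarrow> poly_bounded (\<lambda>B. g B ^ c)"
  by (induction c) (auto intro: poly_bounded_const poly_bounded_mult)

lemmas poly_bounded_intros =
  poly_bounded_const poly_bounded_id poly_bounded_add poly_bounded_mult poly_bounded_power

lemma poly_bounded_cost: "poly_bounded (cost e)"
proof (induction e)
  case (Num c) show ?case using poly_bounded_const[of 1] by (simp add: fun_eq_iff)
qed (auto simp: fun_eq_iff simp del: add_2_eq_Suc' intro!: poly_bounded_intros)

section \<open>Expressions on graphs\<close>

definition holds :: "aexp \<Rightarrow> (nat \<Rightarrow> nat) \<Rightarrow> (nat \<Rightarrow> nat \<Rightarrow> nat) \<Rightarrow> bool" where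
  "holds e \<rho> \<alpha> \<longleftrightarrow> aval e \<rho> \<alpha> \<noteq> 0"

text \<open>Truth is being nonzero. Truncated subtraction normalizes to 0 or 1, so
  \<open>Sum\<close> can serve both as an existential quantifier and as a counter.\<close>

definition notE :: "aexp \<Rightarrow> aexp" where "notE e = Minus (Num 1) e"
definition andE :: "aexp \<Rightarrow> aexp \<Rightarrow> aexp" where "andE d e = notE (Plus (notE d) (notE e))"
definition impE :: "aexp \<Rightarrow> aexp \<Rightarrow> aexp" where "impE d e = notE (andE d (notE e))"
definition allE :: "nat \<Rightarrow> nat \<Rightarrow> aexp \<Rightarrow> aexp" where "allE x y e = notE (Sum x y (notE e))"
definition leE :: "aexp \<Rightarrow> aexp \<Rightarrow> aexp" where "leE d e = notE (Minus d e)"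
text \<open>The absolute difference; on arguments in \<open>{0, 1}\<close> its value is 0 or 1, so
  that summing it counts.\<close>

definition neqE :: "aexp \<Rightarrow> aexp \<Rightarrow> aexp" where "neqE d e = Plus (Minus d e) (Minus e d)"

lemma aval_notE: "aval (notE e) \<rho> \<alpha> = of_bool (\<not> holds e \<rho> \<alpha>)"
  by (auto simp: notE_def holds_def)

lemma aval_andE: "aval (andE d e) \<rho> \<alpha> = of_bool (holds d \<rho> \<alpha> \<and> holds e \<rho> \<alpha>)"
  by (auto simp: andE_def aval_notE holds_def)

lemma holds_simps [simp]:
  "holds (notE e) \<rho> \<alpha> \<longleftrightarrow> \<not> holds e \<rho> \<alpha>"
  "holds (andE d e) \<rho> \<alpha> \<longleftrightarrow> holds d \<rho> \<alpha> \<and> holds e \<rho> \<alpha>"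
  "holds (impE d e) \<rho> \<alpha> \<longleftrightarrow> (holds d \<rho> \<alpha> \<longrightarrow> holds e \<rho> \<alpha>)"
  "holds (Sum x y e) \<rho> \<alpha> \<longleftrightarrow> (\<exists>i<\<rho> y. holds e (\<rho>(x := i)) \<alpha>)"
  "holds (allE x y e) \<rho> \<alpha> \<longleftrightarrow> (\<forall>i<\<rho> y. holds e (\<rho>(x := i)) \<alpha>)"
  "holds (leE d e) \<rho> \<alpha> \<longleftrightarrow> aval d \<rho> \<alpha> \<le> aval e \<rho> \<alpha>"
  "holds (neqE d e) \<rho> \<alpha> \<longleftrightarrow> aval d \<rho> \<alpha> \<noteq> aval e \<rho> \<alpha>"
  "holds (Plus d e) \<rho> \<alpha> \<longleftrightarrow> holds d \<rho> \<alpha> \<or> holds e \<rho> \<alpha>"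
  "holds (Minus d e) \<rho> \<alpha> \<longleftrightarrow> aval e \<rho> \<alpha> < aval d \<rho> \<alpha>"
proof -
  show n: "holds (notE e) \<rho> \<alpha> \<longleftrightarrow> \<not> holds e \<rho> \<alpha>" for e by (simp add: holds_def[of "notE e"] aval_notE)
  show a: "holds (andE d e) \<rho> \<alpha> \<longleftrightarrow> holds d \<rho> \<alpha> \<and> holds e \<rho> \<alpha>" for d e
    by (simp add: holds_def[of "andE d e"] aval_andE)
  show "holds (impE d e) \<rho> \<alpha> \<longleftrightarrow> (holds d \<rho> \<alpha> \<longrightarrow> holds e \<rho> \<alpha>)" by (simp add: impE_def n a)
  show s: "holds (Sum x y e) \<rho> \<alpha> \<longleftrightarrow> (\<exists>i<\<rho> y. holds e (\<rho>(x := i)) \<alpha>)" for e by (auto simp: holds_def)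
  have "holds (notE e) \<rho> \<alpha> \<longleftrightarrow> \<not> holds e \<rho> \<alpha>" for e \<rho> by (simp add: holds_def[of "notE e"] aval_notE)
  then show "holds (allE x y e) \<rho> \<alpha> \<longleftrightarrow> (\<forall>i<\<rho> y. holds e (\<rho>(x := i)) \<alpha>)" by (simp add: allE_def s)
  show "holds (leE d e) \<rho> \<alpha> \<longleftrightarrow> aval d \<rho> \<alpha> \<le> aval e \<rho> \<alpha>" by (auto simp: leE_def n holds_def[of "Minus d e"])
qed (auto simp: holds_def neqE_def)

lemma holds_Cell [simp]: "holds (Cell b e) \<rho> \<alpha> \<longleftrightarrow> \<alpha> b (aval e \<rho> \<alpha>) \<noteq> 0"
  by (simp add: holds_def)

text \<open>Register \<open>1\<close> holds \<open>n\<close>, register \<open>2\<close> holds \<open>k\<close>, register \<open>3\<close> the radius \<open>4 k\<^sup>3\<close>, register \<open>4\<close> the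
  bound \<open>4 k\<^sup>6\<close> on the number of exceptional neighbors and register \<open>8\<close> the bound \<open>2\<^bsup>k\<^sup>2\<^esup>\<close> on the
  number of representatives. Array \<open>0\<close> is the adjacency matrix, array \<open>1\<close> marks the representatives,
  and array \<open>2\<close> stores the bit for \<open>(v, c)\<close> at index \<open>n c + v\<close>.\<close>

definition adjE :: "nat \<Rightarrow> nat \<Rightarrow> aexp" where
  "adjE u v = Cell 0 (Plus (Sum 28 1 (Var u)) (Var v))"
definition distE :: "nat \<Rightarrow> nat \<Rightarrow> aexp" where
  "distE x r = Sum 21 1 (neqE (adjE x 21) (adjE r 21))"
definition nearE :: "nat \<Rightarrow> nat \<Rightarrow> aexp" where
  "nearE x r = leE (distE x r) (Var 3)"
definition commonE :: "nat \<Rightarrow> nat \<Rightarrow> aexp" where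
  "commonE y r = andE (adjE r y) (allE 20 1 (impE (nearE 20 r) (adjE 20 y)))"
text \<open>Register 9 holds the vertex under consideration and also bounds the sum, so only smaller
  vertices are consulted.\<close>

definition repE :: aexp where
  "repE = notE (Sum 22 9 (andE (Cell 1 (Var 22)) (nearE 9 22)))"
definition yesE :: aexp where
  "yesE = Plus (Minus (Sum 22 1 (Cell 1 (Var 22))) (Var 8))
     (Sum 22 1 (andE (Cell 1 (Var 22))
       (notE (leE (Sum 29 1 (andE (adjE 22 29) (notE (commonE 29 22)))) (Var 4)))))"
text \<open>Without multiplication on the machine, \<open>n * c\<close> is the sum of
  \<open>n\<close> copies of \<open>c\<close>; \<open>adjE\<close> does the same.\<close>

definition bitE :: "nat \<Rightarrow> aexp \<Rightarrow> aexp" where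
  "bitE v c = Cell 2 (Plus (Sum 28 1 c) (Var v))"
definition survivesE :: "nat \<Rightarrow> nat \<Rightarrow> aexp" where
  "survivesE v j = andE (bitE v (Var j))
     (allE 22 1 (impE (andE (Cell 1 (Var 22)) (bitE 22 (Plus (Var 2) (Var j)))) (notE (commonE v 22))))"
definition coloredE :: "nat \<Rightarrow> nat \<Rightarrow> aexp" where
  "coloredE v j = andE (survivesE v j)
     (andE (allE 30 1 (impE (adjE v 30) (notE (survivesE 30 j))))
        (allE 31 2 (impE (neqE (Var 31) (Var j)) (notE (survivesE v 31)))))"
definition acceptsE :: aexp where
  "acceptsE = allE 26 2 (Sum 23 1 (andE (coloredE 23 26)
     (allE 24 26 (Sum 25 1 (andE (adjE 23 25) (coloredE 25 24))))))"

locale grundy_instance = pair_graph G for G :: "nat pair_pre_digraph" +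
  fixes n k :: nat
  assumes verts: "pverts G = {..<n}" and k1: "1 \<le> k"
begin

definition env :: "(nat \<Rightarrow> nat) \<Rightarrow> (nat \<Rightarrow> nat \<Rightarrow> nat) \<Rightarrow> bool" where
  "env \<rho> \<alpha> \<longleftrightarrow> \<rho> 1 = n \<and> \<rho> 2 = k \<and> \<rho> 3 = 4 * k ^ 3 \<and> \<rho> 4 = 4 * k ^ 6 \<and> \<rho> 8 = 2 ^ k\<^sup>2 \<and>
     (\<forall>u<n. \<forall>v<n. \<alpha> 0 (n * u + v) = of_bool (v \<in> nbs G u))"

definition reps :: "(nat \<Rightarrow> nat \<Rightarrow> nat) \<Rightarrow> nat set" where
  "reps \<alpha> = {v. v < n \<and> \<alpha> 1 v \<noteq> 0}"

definition bits :: "(nat \<Rightarrow> nat \<Rightarrow> nat) \<Rightarrow> (nat \<times> nat) set" where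
  "bits \<alpha> = {(v, c). v < n \<and> \<alpha> 2 (n * c + v) \<noteq> 0}"

lemma env_update [simp]: "x = 0 \<or> 9 \<le> x \<Longrightarrow> env (\<rho>(x := i)) \<alpha> \<longleftrightarrow> env \<rho> \<alpha>"
  by (auto simp: env_def)

lemma envD: "env \<rho> \<alpha> \<Longrightarrow> \<rho> 1 = n \<and> \<rho> (Suc 0) = n \<and> \<rho> 2 = k \<and> \<rho> 3 = 4 * k ^ 3 \<and> \<rho> 4 = 4 * k ^ 6 \<and> \<rho> 8 = 2 ^ k\<^sup>2"
  by (auto simp: env_def)

lemma nbs_less: "v \<in> nbs G u \<Longrightarrow> v < n"
  using nbs_subset verts by blast

lemma aval_adjE:
  assumes "env \<rho> \<alpha>" "u \<noteq> 28" "\<rho> u < n" "\<rho> v < n"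
  shows "aval (adjE u v) \<rho> \<alpha> = of_bool (\<rho> v \<in> nbs G (\<rho> u))"
  using assms by (auto simp: adjE_def env_def)

lemma holds_adjE:
  assumes "env \<rho> \<alpha>" "u \<noteq> 28" "\<rho> u < n" "\<rho> v < n"
  shows "holds (adjE u v) \<rho> \<alpha> \<longleftrightarrow> \<rho> v \<in> nbs G (\<rho> u)"
  using aval_adjE[OF assms] by (simp add: holds_def)

text \<open>Here and below, the excluded register numbers are those bound inside the expression;
  they would capture the arguments.\<close>

lemma aval_distE:
  assumes "env \<rho> \<alpha>" "x \<notin> {21, 28}" "r \<notin> {21, 28}" "\<rho> x < n" "\<rho> r < n"
  shows "aval (distE x r) \<rho> \<alpha> = nb_dist G (\<rho> x) (\<rho> r)"
proof -
  have "aval (neqE (adjE x 21) (adjE r 21)) (\<rho>(21 := i)) \<alpha> =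
      of_bool ((i \<in> nbs G (\<rho> x)) \<noteq> (i \<in> nbs G (\<rho> r)))" if "i < n" for i
    using assms that by (simp add: aval_adjE neqE_def)
  then have "aval (distE x r) \<rho> \<alpha> = (\<Sum>i<n. of_bool ((i \<in> nbs G (\<rho> x)) \<noteq> (i \<in> nbs G (\<rho> r))))"
    unfolding distE_def using envD[OF assms(1)] by simp
  also have "\<dots> = card {i. i < n \<and> ((i \<in> nbs G (\<rho> x)) \<noteq> (i \<in> nbs G (\<rho> r)))}"
    by (simp add: sum_of_bool_eq Int_def)
  also have "{i. i < n \<and> ((i \<in> nbs G (\<rho> x)) \<noteq> (i \<in> nbs G (\<rho> r)))} =
      (nbs G (\<rho> x) - nbs G (\<rho> r)) \<union> (nbs G (\<rho> r) - nbs G (\<rho> x))"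
    using nbs_less by auto
  finally show ?thesis by (simp add: nb_dist_def)
qed

lemma holds_nearE:
  assumes "env \<rho> \<alpha>" "x \<notin> {21, 28}" "r \<notin> {21, 28}" "\<rho> x < n" "\<rho> r < n"
  shows "holds (nearE x r) \<rho> \<alpha> \<longleftrightarrow> \<rho> x \<in> near G k (\<rho> r)"
  using aval_distE[OF assms] assms envD[OF assms(1)] by (simp add: nearE_def near_def verts)

lemma holds_commonE:
  assumes "env \<rho> \<alpha>" "y \<notin> {20, 21, 28}" "r \<notin> {20, 21, 28}" "\<rho> y < n" "\<rho> r < n"
  shows "holds (commonE y r) \<rho> \<alpha> \<longleftrightarrow> \<rho> y \<in> common G k (\<rho> r)"
  using assms envD[OF assms(1)]
  by (auto simp: commonE_def common_def holds_adjE holds_nearE near_def verts)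

lemma holds_repE:
  assumes "env \<rho> \<alpha>" "\<rho> 9 < n"
  shows "holds repE \<rho> \<alpha> \<longleftrightarrow> \<not> (\<exists>r<\<rho> 9. \<alpha> 1 r \<noteq> 0 \<and> \<rho> 9 \<in> near G k r)"
  using assms by (auto simp: repE_def holds_nearE)

lemma holds_yesE:
  assumes "env \<rho> \<alpha>" "\<And>v. v < n \<Longrightarrow> \<alpha> 1 v \<le> 1"
  shows "holds yesE \<rho> \<alpha> \<longleftrightarrow> 2 ^ k\<^sup>2 < card (reps \<alpha>) \<or>
    (\<exists>r\<in>reps \<alpha>. 4 * k ^ 6 < card (nbs G r - common G k r))"
proof -
  note env = envD[OF assms(1)]
  \<comment> \<open>The marks are 0 or 1, so their sum counts the representatives.\<close>
  have "(\<Sum>i<n. \<alpha> 1 i) = (\<Sum>i<n. of_bool (\<alpha> 1 i \<noteq> 0))"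
    using assms(2) by (intro sum.cong refl) (force simp: le_Suc_eq)
  also have "\<dots> = card (reps \<alpha>)" by (simp add: sum_of_bool_eq Int_def reps_def)
  finally have "aval (Sum 22 1 (Cell 1 (Var 22))) \<rho> \<alpha> = card (reps \<alpha>)" using env by simp
  moreover have "aval (Sum 29 1 (andE (adjE 22 29) (notE (commonE 29 22)))) (\<rho>(22 := r)) \<alpha> =
      card (nbs G r - common G k r)" if "r < n" for r
  proof -
    have "aval (Sum 29 1 (andE (adjE 22 29) (notE (commonE 29 22)))) (\<rho>(22 := r)) \<alpha> =
        (\<Sum>i<n. of_bool (i \<in> nbs G r \<and> i \<notin> common G k r))"
      using that assms(1) env by (auto simp: aval_andE holds_adjE holds_commonE intro!: sum.cong)
    also have "\<dots> = card {i. i < n \<and> i \<in> nbs G r \<and> i \<notin> common G k r}"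
      by (simp add: sum_of_bool_eq Int_def)
    also have "{i. i < n \<and> i \<in> nbs G r \<and> i \<notin> common G k r} = nbs G r - common G k r"
      using nbs_less by auto
    finally show ?thesis .
  qed
  ultimately show ?thesis
    using env unfolding yesE_def reps_def
    by (auto simp del: aval.simps(6) simp: not_le)
qed

lemma holds_bitE:
  assumes "env \<rho> \<alpha>" "\<rho> v < n" "\<And>i. aval c (\<rho>(28 := i)) \<alpha> = x"
  shows "holds (bitE v c) \<rho> \<alpha> \<longleftrightarrow> (\<rho> v, x) \<in> bits \<alpha>"
  using assms envD[OF assms(1)] by (simp add: bitE_def bits_def)

lemma holds_survivesE:
  assumes "env \<rho> \<alpha>" "v \<notin> {20, 21, 22, 28}" "j \<notin> {20, 21, 22, 28}" "\<rho> v < n"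
  shows "holds (survivesE v j) \<rho> \<alpha> \<longleftrightarrow> survives G k (reps \<alpha>) (bits \<alpha>) (\<rho> v) (\<rho> j)"
  using assms envD[OF assms(1)]
  by (auto simp: survivesE_def survives_def reps_def holds_commonE holds_bitE[where x = "\<rho> j"]
     holds_bitE[where x = "k + \<rho> j"])

lemma holds_coloredE:
  assumes "env \<rho> \<alpha>" "v \<notin> {20, 21, 22, 28, 30, 31}" "j \<notin> {20, 21, 22, 28, 30, 31}" "\<rho> v < n"
  shows "holds (coloredE v j) \<rho> \<alpha> \<longleftrightarrow> colored G k (reps \<alpha>) (bits \<alpha>) (\<rho> v) (\<rho> j)"
  using assms envD[OF assms(1)] nbs_less
  by (auto simp: coloredE_def colored_def holds_adjE holds_survivesE)

lemma holds_acceptsE: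
  assumes "env \<rho> \<alpha>"
  shows "holds acceptsE \<rho> \<alpha> \<longleftrightarrow> accepts G k (reps \<alpha>) (bits \<alpha>)"
proof -
  have "holds acceptsE \<rho> \<alpha> \<longleftrightarrow> (\<forall>i<k. \<exists>v<n. colored G k (reps \<alpha>) (bits \<alpha>) v i \<and>
      (\<forall>j<i. \<exists>u<n. u \<in> nbs G v \<and> colored G k (reps \<alpha>) (bits \<alpha>) u j))"
    using assms envD[OF assms] by (simp add: acceptsE_def holds_adjE holds_coloredE cong: conj_cong)
  also have "\<dots> \<longleftrightarrow> accepts G k (reps \<alpha>) (bits \<alpha>)"
    unfolding accepts_def verts using nbs_less by (meson lessThan_iff)
  finally show ?thesis .
qed

end

section \<open>The program\<close>

text \<open>Named registers stay below 40; evaluation uses scratch registers from 40 on.\<close>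

definition ASSIGN :: "nat \<Rightarrow> aexp \<Rightarrow> com" where
  "ASSIGN x e = SEQ (compile e 40) (COPY x 40)"

definition UPDATE :: "nat \<Rightarrow> nat \<Rightarrow> aexp \<Rightarrow> com" where
  "UPDATE b x e = SEQ (compile e 40) (STORE b x 40)"

lemma exec_ASSIGN:
  assumes "wf_exp 40 e" "\<And>y. y \<in> bnds e \<Longrightarrow> regs s y \<le> B"
  obtains s' where "exec (ASSIGN x e) s (cost e B + 2) s'" "arrs s' = arrs s"
    "\<And>z. z < 40 \<Longrightarrow> regs s' z = (if z = x then aval e (regs s) (arrs s) else regs s z)"
proof -
  obtain s1 where s1: "exec (compile e 40) s (cost e B) s1" "arrs s1 = arrs s"
    "regs s1 40 = aval e (regs s) (arrs s)" "\<forall>z<40. regs s1 z = regs s z"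
    using compile_correct[OF assms] by auto
  have "exec (ASSIGN x e) s (cost e B + 2) (set_reg x (regs s1 40) s1)"
    unfolding ASSIGN_def using exec_SEQ[OF s1(1) exec_COPY[of x 40]] by simp
  then show thesis using that s1 by force
qed

lemma exec_UPDATE:
  assumes "wf_exp 40 e" "\<And>y. y \<in> bnds e \<Longrightarrow> regs s y \<le> B" "x < 40"
  obtains s' where "exec (UPDATE b x e) s (cost e B + 2) s'"
    "arrs s' = (arrs s)(b := (arrs s b)(regs s x := aval e (regs s) (arrs s)))"
    "\<And>z. z < 40 \<Longrightarrow> regs s' z = regs s z"
proof -
  obtain s1 where s1: "exec (compile e 40) s (cost e B) s1" "arrs s1 = arrs s"
    "regs s1 40 = aval e (regs s) (arrs s)" "\<forall>z<40. regs s1 z = regs s z"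
    using compile_correct[OF assms(1,2)] by auto
  have "exec (UPDATE b x e) s (cost e B + 2) (set_arr b (regs s1 x) (regs s1 40) s1)"
    unfolding UPDATE_def using exec_SEQ[OF s1(1) exec_STORE[of b x 40]] by simp
  then show thesis using that s1 assms(3) by force
qed

text \<open>Summing over a range of length \<open>k\<close>, the content of register 2, multiplies
  by \<open>k\<close>.\<close>

primrec kpow :: "nat \<Rightarrow> aexp" where
  "kpow 0 = Num 1"
| "kpow (Suc i) = Sum 20 2 (kpow i)"

primrec doubled :: "nat \<Rightarrow> aexp \<Rightarrow> aexp" where
  "doubled 0 e = e"
| "doubled (Suc i) e = Plus (doubled i e) (doubled i e)"

lemma kpow [simp]: "aval (kpow i) \<rho> \<alpha> = \<rho> 2 ^ i" "wf_exp 40 (kpow i)" "bnds (kpow i) \<subseteq> {2}"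
  by (induction i arbitrary: \<rho>) auto

lemma doubled [simp]: "aval (doubled i e) \<rho> \<alpha> = 2 ^ i * aval e \<rho> \<alpha>"
  "wf_exp r (doubled i e) = wf_exp r e" "bnds (doubled i e) = bnds e"
  by (induction i) auto

definition POW2 :: "nat \<Rightarrow> nat \<Rightarrow> com" where
  "POW2 x y = SEQ (ASSIGN x (Num 1)) (FOR 17 9 y 14 (ASSIGN x (Plus (Var x) (Var x))))"

text \<open>A symbolic store that grows during initialization while the input matrix
  \<open>A\<close> stays intact.\<close>

definition known :: "(nat \<Rightarrow> nat) \<Rightarrow> (nat \<times> nat) list \<Rightarrow> ram_state \<Rightarrow> bool" where
  "known A vs s \<longleftrightarrow> (\<forall>(z, v)\<in>set vs. regs s z = v) \<and> arrs s 0 = A"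

lemma known_set_reg [simp]: "z \<notin> fst ` set vs \<Longrightarrow> known A vs (set_reg z a s) = known A vs s"
  unfolding known_def by (force simp: image_iff split: prod.splits)

lemma ert_ASSIGN_known:
  assumes "known A vs s" "fst ` set vs \<subseteq> {..<40}" "x \<notin> fst ` set vs" "x < 40"
    and "wf_exp 40 e" "\<And>y. y \<in> bnds e \<Longrightarrow> regs s y \<le> B" "aval e (regs s) (arrs s) = w"
  shows "ert (ASSIGN x e) s (cost e B + 2) (known A ((x, w) # vs)) (\<lambda>_. q) q"
proof -
  obtain s' where s': "exec (ASSIGN x e) s (cost e B + 2) s'" "arrs s' = arrs s"
    "\<And>z. z < 40 \<Longrightarrow> regs s' z = (if z = x then aval e (regs s) (arrs s) else regs s z)"
    using exec_ASSIGN[OF assms(5,6)] by blast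
  have "regs s' z = v" if zv: "(z, v) \<in> set vs" for z v
  proof -
    have "z \<in> fst ` set vs" using zv by (force simp: image_iff)
    then have "z < 40" "z \<noteq> x" using assms(2,3) by auto
    then show ?thesis using s'(3)[of z] assms(1) zv unfolding known_def by auto
  qed
  then have "known A ((x, w) # vs) s'"
    using s'(2) s'(3)[OF assms(4)] assms(1,7) unfolding known_def by auto
  then show ?thesis by (intro ert_exec[OF s'(1)]) auto
qed

lemma ert_POW2_known:
  assumes vs: "known A vs s" "fst ` set vs \<subseteq> {..<40}" "x \<notin> fst ` set vs" "9 \<notin> fst ` set vs" "14 \<notin> fst ` set vs"
    and x: "x < 40" "x \<notin> {9, 14, 17}" and y: "y \<notin> {9, 14}" "(y, m) \<in> set vs" "(17, 1) \<in> set vs" and m: "m \<le> C"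
  shows "ert (POW2 x y) s (C * 13 + 9) (known A ((x, 2 ^ m) # vs)) (\<lambda>_. q) q"
proof -
  have y': "y \<noteq> x" using vs(3) y(2) by (force simp: image_iff)
  have "ert (POW2 x y) s ((cost (Num 1) 0 + 2) + (m * (7 + 6) + 5) + 1) (known A ((x, 2 ^ m) # vs)) (\<lambda>_. q) q"
    unfolding POW2_def
  proof (rule ert_SEQ[OF ert_ASSIGN_known])
    fix s' assume s': "known A ((x, 1) # vs) s'"
    have "ert (FOR 17 9 y 14 (ASSIGN x (Plus (Var x) (Var x)))) s' (m * (7 + 6) + 5)
      (\<lambda>s'. known A ((x, 2 ^ m) # vs) s' \<and> regs s' 17 = 1) (\<lambda>_. q) q"
    proof (rule ert_FOR[where Inv = "\<lambda>i. known A ((x, 2 ^ i) # vs)" and f = "\<lambda>_ _. q"])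
      show "regs s' 17 = 1" "regs s' y = m" using s' y unfolding known_def by auto
      show "known A ((x, 2 ^ 0) # vs) s'" using s' by simp
      fix i s assume s: "known A ((x, 2 ^ i) # vs) s" "regs s 9 = i" "regs s 17 = 1"
      obtain s' where s': "exec (ASSIGN x (Plus (Var x) (Var x))) s (cost (Plus (Var x) (Var x)) 0 + 2) s'"
        "arrs s' = arrs s" "\<And>z. z < 40 \<Longrightarrow> regs s' z = (if z = x then aval (Plus (Var x) (Var x)) (regs s) (arrs s) else regs s z)"
        using exec_ASSIGN[of "Plus (Var x) (Var x)" s 0 x] x by auto
      have "regs s' z = v" if zv: "(z, v) \<in> set vs" for z v
      proof -
        have "z \<in> fst ` set vs" using zv by (force simp: image_iff)
        then have "z < 40" "z \<noteq> x" using vs(2,3) by auto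
        then show ?thesis using s'(3)[of z] s(1) zv unfolding known_def by auto
      qed
      then have "known A ((x, 2 ^ Suc i) # vs) s'"
        using s'(2) s'(3)[OF x(1)] s(1) unfolding known_def by auto
      then show "ert (ASSIGN x (Plus (Var x) (Var x))) s 7
           (\<lambda>s'. known A ((x, 2 ^ Suc i) # vs) s' \<and> regs s' 9 = regs s 9 \<and> regs s' 14 = regs s 14 \<and> regs s' 17 = 1)
           (\<lambda>_. q) q"
        using s'(1,3) x s(3) by (intro ert_exec[of _ _ _ s']) auto
    qed (use vs x y y' in \<open>auto simp: image_iff\<close>)
    then show "ert (FOR 17 9 y 14 (ASSIGN x (Plus (Var x) (Var x)))) s' (m * (7 + 6) + 5)
      (known A ((x, 2 ^ m) # vs)) (\<lambda>_. q) q" by (rule ert_mono) auto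
  qed (use vs x in auto)
  then show ?thesis by (rule ert_mono) (use m in auto)
qed

primrec ASSIGNS :: "(nat \<times> aexp) list \<Rightarrow> com" where
  "ASSIGNS [] = SKIP"
| "ASSIGNS (xe # xes) = SEQ (ASSIGN (fst xe) (snd xe)) (ASSIGNS xes)"

text \<open>In order: the radius, the exception bound, the number \<open>16 * k^2\<close> of tosses
  per bit, the number \<open>2 * k * n\<close> of bits, and the exponents \<open>k^2\<close> and
  \<open>64 * k ^ 4\<close> of the bound on representatives and of the number of trials.\<close>

definition parameters :: "(nat \<times> aexp) list" where
  "parameters = [(3, doubled 2 (kpow 3)), (4, doubled 2 (kpow 6)), (5, doubled 4 (kpow 2)),
     (6, doubled 1 (Sum 20 1 (Var 2))), (18, kpow 2), (19, doubled 6 (kpow 4))]"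

definition INIT :: com where
  "INIT = SEQ (SET 17 1) (SEQ (ASSIGNS parameters) (SEQ (POW2 8 18) (POW2 7 19)))"

definition REPS :: com where
  "REPS = FOR 17 9 1 14 (UPDATE 1 9 repE)"

definition BIT :: com where
  "BIT = SEQ (SET 13 1) (FOR 17 11 5 16 (SEQ (FLIP 12) (ASSIGN 13 (andE (Var 13) (Var 12)))))"

definition BITS :: com where
  "BITS = FOR 17 9 6 14 (SEQ BIT (STORE 2 9 13))"

text \<open>Register 0 is only ever increased here, so a Yes found earlier persists.\<close>

definition TRIAL :: com where
  "TRIAL = SEQ BITS (ASSIGN 0 (Plus (Var 0) acceptsE))"

definition GRUNDY :: com where
  "GRUNDY = SEQ INIT (SEQ REPS (SEQ (ASSIGN 0 yesE) (FOR 17 10 7 15 TRIAL)))"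

lemmas exp_defs = notE_def andE_def impE_def allE_def leE_def neqE_def adjE_def distE_def nearE_def commonE_def
  repE_def yesE_def bitE_def survivesE_def coloredE_def acceptsE_def

lemma wf_exps [simp]: "wf_exp 40 repE" "wf_exp 40 yesE" "wf_exp 40 acceptsE"
  by (simp_all add: exp_defs)

lemma bnds_exps: "bnds repE \<subseteq> {1, 9}" "bnds yesE \<subseteq> {1}" "bnds acceptsE \<subseteq> {1, 2}"
  by (auto simp: exp_defs)

text \<open>The two doubling loops take at most \<open>X\<close> and \<open>64 * X\<close> rounds of
  cost 13, and \<open>845 = 13 + 64 * 13\<close>.\<close>

definition init_time :: "nat \<Rightarrow> nat" where
  "init_time X = (\<Sum>xe\<leftarrow>parameters. cost (snd xe) X + 3) + X * 845 + 22"
definition reps_time :: "nat \<Rightarrow> nat" where "reps_time X = X * (cost repE X + 8) + 5"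
definition bit_time :: "nat \<Rightarrow> nat" where "bit_time X = 16 * X * (cost (andE (Var 13) (Var 12)) X + 10) + 7"
definition bits_time :: "nat \<Rightarrow> nat" where "bits_time X = 2 * X * X * (bit_time X + 8) + 5"
definition trial_time :: "nat \<Rightarrow> nat" where "trial_time X = bits_time X + cost acceptsE X + 7"
definition total_time :: "nat \<Rightarrow> nat" where
  "total_time X = init_time X + reps_time X + cost yesE X + X ^ 64 * (trial_time X + 6) + 10"

lemma poly_bounded_sum_list: "(\<And>x. x \<in> set xs \<Longrightarrow> poly_bounded (g x)) \<Longrightarrow> poly_bounded (\<lambda>B. \<Sum>x\<leftarrow>xs. g x B)"
  by (induction xs) (auto intro: poly_bounded_intros)

lemma poly_bounded_total_time: "poly_bounded total_time"
  unfolding total_time_def[abs_def] init_time_def reps_time_def trial_time_def bits_time_def bit_time_def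
  by (intro poly_bounded_intros poly_bounded_cost poly_bounded_sum_list)

context grundy_instance
begin

text \<open>Powers of \<open>X\<close> are exactly of the form allowed for the running time, so it
  suffices to be polynomial in \<open>X\<close>; the number of trials is at most
  \<open>X ^ 64\<close>.\<close>

definition X :: nat where "X = 2 ^ k ^ 4 * max 1 n"

lemma X_ge: "2 \<le> X" "n \<le> X" "k \<le> X" "k\<^sup>2 \<le> X" "k ^ 4 \<le> X" "2 ^ (64 * k ^ 4) \<le> X ^ 64"
proof -
  have "1 \<le> k ^ 4" using k1 by simp
  then have two: "(2::nat) \<le> 2 ^ k ^ 4" using power_increasing[of 1 "k ^ 4" "2::nat"] by simp
  have le: "2 ^ k ^ 4 \<le> X" "max 1 n \<le> X" unfolding X_def by (simp, metis mult_le_mono1 mult_1 one_le_numeral one_le_power)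
  show "2 \<le> X" using two le by simp
  show "n \<le> X" using le by simp
  show k4: "k ^ 4 \<le> X" using le less_exp[of "k ^ 4"] by linarith
  have "k\<^sup>2 \<le> k ^ 4" "k \<le> k ^ 4" using k1 by (auto intro!: power_increasing self_le_power)
  then show "k\<^sup>2 \<le> X" "k \<le> X" using k4 by auto
  have "2 ^ (64 * k ^ 4) = ((2::nat) ^ k ^ 4) ^ 64" by (simp add: power_mult[symmetric] mult.commute)
  then show "2 ^ (64 * k ^ 4) \<le> X ^ 64" using le(1) by (simp add: power_mono)
qed

definition base :: "ram_state \<Rightarrow> bool" where
  "base s \<longleftrightarrow> env (regs s) (arrs s) \<and> regs s 5 = 16 * k\<^sup>2 \<and> regs s 6 = 2 * k * n \<and> regs s 7 = 2 ^ (64 * k ^ 4)"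

lemma base_set_reg [simp]: "x = 0 \<or> 9 \<le> x \<Longrightarrow> base (set_reg x a s) = base s"
  by (auto simp: base_def)

lemma base_cong: "base s \<Longrightarrow> (\<And>z. 1 \<le> z \<Longrightarrow> z \<le> 8 \<Longrightarrow> regs s' z = regs s z) \<Longrightarrow> arrs s' 0 = arrs s 0 \<Longrightarrow> base s'"
  by (auto simp: base_def env_def)

lemma ert_ASSIGNS:
  assumes "known A vs s" "(1, n) \<in> set vs" "(2, k) \<in> set vs" "fst ` set vs \<subseteq> {..<40}"
    and "\<And>x e. (x, e) \<in> set xes \<Longrightarrow> x < 40 \<and> wf_exp 40 e \<and> bnds e \<subseteq> {1, 2}"
    and "\<And>x e \<rho> \<alpha>. (x, e) \<in> set xes \<Longrightarrow> \<rho> 1 = n \<Longrightarrow> \<rho> 2 = k \<Longrightarrow> aval e \<rho> \<alpha> = w x"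
    and "distinct (map fst xes)" "fst ` set xes \<inter> fst ` set vs = {}"
  shows "ert (ASSIGNS xes) s (\<Sum>xe\<leftarrow>xes. cost (snd xe) X + 3) (known A (rev (map (\<lambda>(x, _). (x, w x)) xes) @ vs)) (\<lambda>_. q) q"
  using assms
proof (induction xes arbitrary: vs s)
  case Nil
  have "exec SKIP s 0 s" by (simp add: runs_def)
  then show ?case using Nil by (auto intro: ert_exec)
next
  case (Cons xe xes)
  obtain x e where xe: "xe = (x, e)" by (cases xe)
  have x: "x < 40" "wf_exp 40 e" "bnds e \<subseteq> {1, 2}" using Cons.prems(5)[of x e] xe by auto
  have r: "regs s 1 = n" "regs s 2 = k" using Cons.prems(1-3) unfolding known_def by auto
  have "ert (ASSIGN x e) s (cost e X + 2) (known A ((x, w x) # vs)) (\<lambda>_. q) q"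
  proof (rule ert_ASSIGN_known[OF Cons.prems(1)])
    show "regs s y \<le> X" if "y \<in> bnds e" for y using that x(3) r X_ge by auto
    show "aval e (regs s) (arrs s) = w x" using Cons.prems(6)[of x e] xe r by simp
  qed (use x Cons.prems xe in auto)
  moreover have "ert (ASSIGNS xes) s' (\<Sum>xe\<leftarrow>xes. cost (snd xe) X + 3)
      (known A (rev (map (\<lambda>(x, _). (x, w x)) xes) @ (x, w x) # vs)) (\<lambda>_. q) q" if "known A ((x, w x) # vs) s'" for s'
    using that
  proof (rule Cons.IH)
    show "aval e \<rho> \<alpha> = w x" if "(x, e) \<in> set xes" "\<rho> 1 = n" "\<rho> 2 = k" for x e \<rho> \<alpha>
      using Cons.prems(6)[of x e] that by simp
    show "x < 40 \<and> wf_exp 40 e \<and> bnds e \<subseteq> {1, 2}" if "(x, e) \<in> set xes" for x e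
      using Cons.prems(5)[of x e] that by simp
  qed (use Cons.prems(2-4,7,8) xe x(1) in auto)
  ultimately have "ert (SEQ (ASSIGN x e) (ASSIGNS xes)) s ((cost e X + 2) + (\<Sum>xe\<leftarrow>xes. cost (snd xe) X + 3) + 1)
      (known A (rev (map (\<lambda>(x, _). (x, w x)) xes) @ (x, w x) # vs)) (\<lambda>_. q) q" by (rule ert_SEQ)
  then show ?case unfolding xe by (simp add: algebra_simps numeral_3_eq_3)
qed

lemma ert_INIT: "ert INIT (graph_input G n k) (init_time X) (\<lambda>s. base s \<and> regs s 17 = 1) (\<lambda>_. q) q"
proof -
  define s0 where "s0 = graph_input G n k"
  define A where "A = arrs s0 0"
  define vs0 :: "(nat \<times> nat) list" where "vs0 = [(17, 1), (1, n), (2, k)]"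
  define w :: "nat \<Rightarrow> nat" where "w = (\<lambda>_. 0)(3 := 4 * k ^ 3, 4 := 4 * k ^ 6, 5 := 16 * k\<^sup>2, 6 := 2 * (n * k),
    18 := k\<^sup>2, 19 := 64 * k ^ 4)"
  define vs1 where "vs1 = rev (map (\<lambda>(x, _). (x, w x)) parameters) @ vs0"
  define vs2 where "vs2 = (8, 2 ^ k\<^sup>2) # vs1"
  define vs3 where "vs3 = (7, 2 ^ (64 * k ^ 4)) # vs2"
  note defs = vs0_def vs1_def vs2_def vs3_def parameters_def w_def
  have "ert INIT s0 (1 + ((\<Sum>xe\<leftarrow>parameters. cost (snd xe) X + 3) + ((X * 13 + 9) + (64 * X * 13 + 9) + 1) + 1) + 1)
     (known A vs3) (\<lambda>_. q) q"
    unfolding INIT_def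
  proof (rule ert_SEQ_exec[OF exec_SET], rule ert_SEQ[where R = "known A vs1" and f = "\<lambda>_. q"])
    have k0: "known A vs0 (set_reg 17 1 s0)"
      unfolding known_def A_def vs0_def s0_def graph_input_def by simp
    have bk: "y = 2" if "y \<in> bnds (kpow i)" for y i using kpow(3)[of i] that by blast
    show "ert (ASSIGNS parameters) (set_reg 17 1 s0) (\<Sum>xe\<leftarrow>parameters. cost (snd xe) X + 3) (known A vs1) (\<lambda>_. q) q"
      unfolding vs1_def by (rule ert_ASSIGNS[OF k0]) (auto simp: vs0_def parameters_def w_def dest: bk)
  next
    fix s assume s: "known A vs1 s"
    show "ert (SEQ (POW2 8 18) (POW2 7 19)) s ((X * 13 + 9) + (64 * X * 13 + 9) + 1) (known A vs3) (\<lambda>_. q) q"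
    proof (rule ert_SEQ[where R = "known A vs2" and f = "\<lambda>_. q"])
      show "ert (POW2 8 18) s (X * 13 + 9) (known A vs2) (\<lambda>_. q) q"
        unfolding vs2_def by (rule ert_POW2_known[OF s]) (use X_ge in \<open>auto simp: defs\<close>)
      show "ert (POW2 7 19) s (64 * X * 13 + 9) (known A vs3) (\<lambda>_. q) q" if "known A vs2 s" for s
        unfolding vs3_def by (rule ert_POW2_known[OF that]) (use X_ge in \<open>auto simp: defs\<close>)
    qed
  qed
  moreover have "base s \<and> regs s 17 = 1" if s: "known A vs3 s" for s
  proof -
    have "arrs s 0 (n * u + v) = of_bool (v \<in> nbs G u)" if uv: "u < n" "v < n" for u v
    proof -
      have "n * u + v < n * Suc u" using uv by simp
      also have "\<dots> \<le> n * n" using uv by (intro mult_le_mono2) simp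
      finally show ?thesis
        using s uv unfolding known_def A_def s0_def graph_input_def nbs_def by simp
    qed
    then show ?thesis using s unfolding base_def env_def known_def defs by simp
  qed
  ultimately show ?thesis
    unfolding s0_def by (elim ert_mono) (auto simp: init_time_def)
qed

end

section \<open>Correctness and running time\<close>

context grundy_instance
begin

section \<open>The greedily computed set of representatives\<close>

definition reps_done :: "nat \<Rightarrow> (nat \<Rightarrow> nat \<Rightarrow> nat) \<Rightarrow> bool" where
  "reps_done i \<alpha> \<longleftrightarrow> (\<forall>v<i. \<alpha> 1 v = of_bool (\<not> (\<exists>r<v. \<alpha> 1 r \<noteq> 0 \<and> v \<in> near G k r)))"

lemma ert_REPS:
  assumes "base s" "regs s 17 = 1"
  shows "ert REPS s (reps_time X) (\<lambda>s. (base s \<and> reps_done n (arrs s)) \<and> regs s 17 = 1) (\<lambda>_. q) q"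
proof -
  have "ert REPS s (n * ((cost repE X + 2) + 6) + 5) (\<lambda>s. (base s \<and> reps_done n (arrs s)) \<and> regs s 17 = 1) (\<lambda>_. q) q"
    unfolding REPS_def
  proof (rule ert_FOR[where Inv = "\<lambda>i s. base s \<and> reps_done i (arrs s)" and f = "\<lambda>_ _. q"])
    show "regs s 1 = n" using assms envD unfolding base_def by blast
    fix i s assume i: "i < n" and s: "base s \<and> reps_done i (arrs s)" "regs s 9 = i" "regs s 17 = 1"
    have env: "env (regs s) (arrs s)" using s unfolding base_def by simp
    have "regs s y \<le> X" if "y \<in> bnds repE" for y
      using that bnds_exps(1) envD[OF env] X_ge i s by auto
    then obtain s' where s': "exec (UPDATE 1 9 repE) s (cost repE X + 2) s'"
      "arrs s' = (arrs s)(1 := (arrs s 1)(regs s 9 := aval repE (regs s) (arrs s)))"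
      "\<And>z. z < 40 \<Longrightarrow> regs s' z = regs s z"
      using exec_UPDATE[of repE s X 9 1] by auto
    have "aval repE (regs s) (arrs s) = of_bool (\<not> (\<exists>r<i. arrs s 1 r \<noteq> 0 \<and> i \<in> near G k r))"
      using holds_repE[OF env] i s(2) unfolding holds_def repE_def aval_notE holds_simps(1) by auto
    then have new: "arrs s' 1 i = of_bool (\<not> (\<exists>r<i. arrs s 1 r \<noteq> 0 \<and> i \<in> near G k r))"
      using s'(2) s(2) by simp
    have old: "arrs s' 1 r = arrs s 1 r" if "r < i" for r using s'(2) s(2) that by simp
    have "reps_done (Suc i) (arrs s')"
      unfolding reps_done_def
    proof (intro allI impI)
      fix v assume v: "v < Suc i"
      have "(\<exists>r<v. arrs s' 1 r \<noteq> 0 \<and> v \<in> near G k r) \<longleftrightarrow> (\<exists>r<v. arrs s 1 r \<noteq> 0 \<and> v \<in> near G k r)"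
        using v old by (intro ex_cong1 conj_cong) auto
      moreover have "arrs s' 1 v = of_bool (\<not> (\<exists>r<v. arrs s 1 r \<noteq> 0 \<and> v \<in> near G k r))"
      proof (cases "v = i")
        case False
        then have "v < i" using v by simp
        then show ?thesis using s(1) old[of v] unfolding reps_done_def by metis
      qed (use new in simp)
      ultimately show "arrs s' 1 v = of_bool (\<not> (\<exists>r<v. arrs s' 1 r \<noteq> 0 \<and> v \<in> near G k r))" by simp
    qed
    moreover have "base s'" using s s'(2,3) by (auto intro: base_cong)
    ultimately show "ert (UPDATE 1 9 repE) s (cost repE X + 2)
       (\<lambda>s'. (base s' \<and> reps_done (Suc i) (arrs s')) \<and> regs s' 9 = regs s 9 \<and> regs s' 14 = regs s 14 \<and> regs s' 17 = 1)
       (\<lambda>_. q) q"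
      using s s'(3) by (intro ert_exec[OF s'(1)]) auto
  qed (use assms in \<open>auto simp: reps_done_def\<close>)
  moreover have "n * ((cost repE X + 2) + 6) + 5 \<le> reps_time X"
  proof -
    have "cost repE X + 2 + 6 = cost repE X + 8" by simp
    then show ?thesis
      using mult_le_mono1[OF X_ge(2), of "cost repE X + 8"] unfolding reps_time_def by (metis add_le_mono1)
  qed
  ultimately show ?thesis by (auto intro: ert_mono)
qed

lemma nb_dist_commute: "nb_dist G x y = nb_dist G y x"
  by (simp add: nb_dist_def Un_commute)

lemma reps_done_iff:
  assumes "reps_done n \<alpha>" "v < n"
  shows "\<alpha> 1 v \<noteq> 0 \<longleftrightarrow> \<not> (\<exists>r<v. \<alpha> 1 r \<noteq> 0 \<and> v \<in> near G k r)"
proof -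
  have "\<alpha> 1 v = of_bool (\<not> (\<exists>r<v. \<alpha> 1 r \<noteq> 0 \<and> v \<in> near G k r))"
    using assms unfolding reps_done_def by blast
  then have "\<alpha> 1 v \<noteq> 0 \<longleftrightarrow> of_bool (\<not> (\<exists>r<v. \<alpha> 1 r \<noteq> 0 \<and> v \<in> near G k r)) \<noteq> (0 :: nat)" by (rule arg_cong)
  then show ?thesis by (simp only: of_bool_eq_0_iff not_not)
qed

text \<open>Nearness is symmetric on vertices, so of two near representatives the larger one would
  have been rejected.\<close>

lemma reps_done_separated:
  assumes "reps_done n \<alpha>" "x \<in> reps \<alpha>" "y \<in> reps \<alpha>" "x \<noteq> y"
  shows "x \<notin> near G k y"
proof -
  have xy: "x < n" "y < n" "\<alpha> 1 x \<noteq> 0" "\<alpha> 1 y \<noteq> 0" using assms(2,3) unfolding reps_def by auto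
  then have "x \<in> near G k y \<longleftrightarrow> y \<in> near G k x" by (simp add: near_def nb_dist_commute[of x y] verts)
  then show ?thesis
    using xy assms(4) reps_done_iff[OF assms(1), of x] reps_done_iff[OF assms(1), of y] by (metis linorder_neqE_nat)
qed

text \<open>A vertex is near itself, and a rejected vertex is near the smaller representative that
  caused the rejection.\<close>

lemma reps_done_covering:
  assumes "reps_done n \<alpha>" "v \<in> pverts G"
  shows "\<exists>r\<in>reps \<alpha>. v \<in> near G k r"
proof (cases "\<alpha> 1 v = 0")
  case True
  then obtain r where "r < v" "\<alpha> 1 r \<noteq> 0" "v \<in> near G k r"
    using assms(2) reps_done_iff[OF assms(1), of v] unfolding verts by auto
  moreover then have "r < n" using assms(2) unfolding verts by simp
  ultimately show ?thesis unfolding reps_def by auto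
next
  case False
  moreover have "v \<in> near G k v" using assms(2) by (simp add: near_def nb_dist_def)
  ultimately show ?thesis using assms(2) unfolding reps_def verts by auto
qed

definition few_exceptions :: "nat set \<Rightarrow> bool" where
  "few_exceptions R \<longleftrightarrow> card R \<le> 2 ^ k\<^sup>2 \<and> (\<forall>r\<in>R. card (nbs G r - common G k r) \<le> 4 * k ^ 6)"

text \<open>The invariant of the trials: a nonzero answer is correct, and a zero answer certifies
  the bounds needed for \<open>accepting_pattern\<close>.\<close>

definition sound :: "ram_state \<Rightarrow> bool" where
  "sound s \<longleftrightarrow> base s \<and> reps_done n (arrs s) \<and> (regs s 0 \<noteq> 0 \<longrightarrow> partial_grundy_yes G k) \<and>
     (regs s 0 = 0 \<longrightarrow> few_exceptions (reps (arrs s)))"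

lemma ert_yesE:
  assumes "base s" "reps_done n (arrs s)" "regs s 17 = 1"
  shows "ert (ASSIGN 0 yesE) s (cost yesE X + 2) (\<lambda>s. sound s \<and> regs s 17 = 1) (\<lambda>_. q) q"
proof -
  have env: "env (regs s) (arrs s)" using assms unfolding base_def by simp
  have "regs s y \<le> X" if "y \<in> bnds yesE" for y
    using that bnds_exps(2) envD[OF env] X_ge by auto
  then obtain s' where s': "exec (ASSIGN 0 yesE) s (cost yesE X + 2) s'" "arrs s' = arrs s"
    "\<And>z. z < 40 \<Longrightarrow> regs s' z = (if z = 0 then aval yesE (regs s) (arrs s) else regs s z)"
    using exec_ASSIGN[of yesE s X 0] by auto
  have "arrs s 1 v \<le> 1" if "v < n" for v using assms(2) that unfolding reps_done_def by simp
  then have "holds yesE (regs s) (arrs s) \<longleftrightarrow> 2 ^ k\<^sup>2 < card (reps (arrs s)) \<or>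
    (\<exists>r\<in>reps (arrs s). 4 * k ^ 6 < card (nbs G r - common G k r))" by (rule holds_yesE[OF env])
  then have iff: "regs s' 0 \<noteq> 0 \<longleftrightarrow> 2 ^ k\<^sup>2 < card (reps (arrs s)) \<or>
    (\<exists>r\<in>reps (arrs s). 4 * k ^ 6 < card (nbs G r - common G k r))"
    using s'(3)[of 0] unfolding holds_def by simp
  have "partial_grundy_yes G k" if "regs s' 0 \<noteq> 0"
    using iff[THEN iffD1, OF that]
  proof
    assume "2 ^ k\<^sup>2 < card (reps (arrs s))"
    then show ?thesis
      using reps_done_separated[OF assms(2)] by (intro yes_if_many_representatives) (auto simp: reps_def verts)
  qed (use yes_if_many_exceptional in blast)
  moreover have "few_exceptions (reps (arrs s'))" if "regs s' 0 = 0"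
    using that iff s'(2) unfolding few_exceptions_def by (auto simp: not_less)
  moreover have "base s'" using assms(1) s'(2,3) by (auto intro: base_cong)
  ultimately have "sound s'" using assms(2) s'(2) unfolding sound_def by simp
  then show ?thesis using s'(3)[of 17] assms(3) by (intro ert_exec[OF s'(1)]) auto
qed

section \<open>Random bits and the success probability of one trial\<close>

text \<open>A random bit is the conjunction of \<open>16 k\<^sup>2\<close> coin tosses.\<close>

definition p :: real where "p = 1 / 2 ^ (16 * k\<^sup>2)"

definition bit_frame :: "ram_state \<Rightarrow> ram_state \<Rightarrow> bool" where
  "bit_frame s s' \<longleftrightarrow> arrs s' = arrs s \<and> (\<forall>z<40. z \<notin> {11, 12, 13, 16} \<longrightarrow> regs s' z = regs s z)"

lemma ert_BIT:
  assumes "base s" "regs s 17 = 1"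
  shows "ert BIT s (bit_time X) (bit_frame s) (\<lambda>s'. if regs s' 13 \<noteq> 0 then a else b) (a * p + b * (1 - p))"
proof -
  define L where "L = 16 * k\<^sup>2"
  \<comment> \<open>A conjunction that is still true survives with probability
    \<open>1 / 2 ^ (L - i)\<close>, as \<open>L - i\<close> tosses are left; a false one stays false
    and is worth \<open>b\<close>.\<close>
  define f where "f i s' = (if regs s' 13 \<noteq> 0 then a / 2 ^ (L - i) + b * (1 - 1 / 2 ^ (L - i)) else b)"
    for i and s' :: ram_state
  define e where "e = andE (Var 13) (Var 12)"
  have we: "wf_exp 40 e" "bnds e = {}" unfolding e_def by (simp_all add: andE_def notE_def)
  have "ert BIT s (1 + (L * ((1 + (cost e X + 2) + 1) + 6) + 5) + 1) (\<lambda>s'. bit_frame s s' \<and> regs s' 17 = 1) (f L)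
     (f 0 (set_reg 13 1 s))"
    unfolding BIT_def e_def[symmetric]
  proof (rule ert_SEQ_exec[OF exec_SET], rule ert_FOR[where Inv = "\<lambda>_. bit_frame s"])
    show "regs (set_reg 13 1 s) 5 = L" using assms unfolding base_def L_def by simp
    fix i s1 assume i: "i < L" and s1: "bit_frame s s1" "regs s1 11 = i" "regs s1 17 = 1"
    show "ert (SEQ (FLIP 12) (ASSIGN 13 e)) s1 (1 + (cost e X + 2) + 1)
      (\<lambda>s'. bit_frame s s' \<and> regs s' 11 = regs s1 11 \<and> regs s' 16 = regs s1 16 \<and> regs s' 17 = 1)
      (f (Suc i)) (f i s1)"
    proof (rule ert_SEQ[where R = "\<lambda>s2. \<exists>c. s2 = set_reg 12 c s1" and
          f = "\<lambda>s2. if regs s2 12 \<noteq> 0 then f (Suc i) s1 else b"])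
      have d: "L - i = Suc (L - Suc i)" using i by simp
      show "ert (FLIP 12) s1 1 (\<lambda>s2. \<exists>c. s2 = set_reg 12 c s1)
         (\<lambda>s2. if regs s2 12 \<noteq> 0 then f (Suc i) s1 else b) (f i s1)"
        by (rule ert_FLIP) (auto simp: f_def d field_simps)
    next
      fix s2 assume "\<exists>c. s2 = set_reg 12 c s1"
      then obtain c where s2: "s2 = set_reg 12 c s1" by blast
      obtain s3 where s3: "exec (ASSIGN 13 e) s2 (cost e X + 2) s3" "arrs s3 = arrs s2"
        "\<And>z. z < 40 \<Longrightarrow> regs s3 z = (if z = 13 then aval e (regs s2) (arrs s2) else regs s2 z)"
        using exec_ASSIGN[of e s2 X 13] we by auto
      have "regs s3 13 = of_bool (regs s1 13 \<noteq> 0 \<and> c \<noteq> 0)"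
        using s3(3)[of 13] s2 unfolding e_def aval_andE by (simp add: holds_def)
      then have "(if regs s2 12 \<noteq> 0 then f (Suc i) s1 else b) \<le> f (Suc i) s3"
        unfolding f_def s2 by auto
      then show "ert (ASSIGN 13 e) s2 (cost e X + 2)
        (\<lambda>s'. bit_frame s s' \<and> regs s' 11 = regs s1 11 \<and> regs s' 16 = regs s1 16 \<and> regs s' 17 = 1)
        (f (Suc i)) (if regs s2 12 \<noteq> 0 then f (Suc i) s1 else b)"
        using s1 s2 s3 by (intro ert_exec[OF s3(1)]) (auto simp: bit_frame_def)
    qed
  qed (use assms in \<open>auto simp: f_def bit_frame_def\<close>)
  moreover have "f 0 (set_reg 13 1 s) = a * p + b * (1 - p)" unfolding f_def p_def L_def by simp
  moreover have "f L = (\<lambda>s'. if regs s' 13 \<noteq> 0 then a else b)" unfolding f_def by auto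
  moreover have "1 + (L * ((1 + (cost e X + 2) + 1) + 6) + 5) + 1 \<le> bit_time X"
  proof -
    have "L * (cost e X + 10) \<le> 16 * X * (cost e X + 10)"
      using X_ge(4) unfolding L_def by (intro mult_le_mono1) simp
    then show ?thesis unfolding bit_time_def e_def by (simp add: algebra_simps)
  qed
  ultimately show ?thesis by (auto intro: ert_mono)
qed

definition bits_frame :: "ram_state \<Rightarrow> ram_state \<Rightarrow> bool" where
  "bits_frame s s' \<longleftrightarrow> arrs s' 0 = arrs s 0 \<and> arrs s' 1 = arrs s 1 \<and>
     (\<forall>z<40. z \<notin> {9, 11, 12, 13, 14, 16} \<longrightarrow> regs s' z = regs s z)"

definition match :: "nat set \<Rightarrow> nat set \<Rightarrow> nat \<Rightarrow> ram_state \<Rightarrow> bool" where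
  "match S1 S0 i s \<longleftrightarrow> (\<forall>l<i. (l \<in> S1 \<longrightarrow> arrs s 2 l \<noteq> 0) \<and> (l \<in> S0 \<longrightarrow> arrs s 2 l = 0))"

lemma base_bits_frame:
  assumes "base s" "bits_frame s s'"
  shows "base s'"
proof (rule base_cong[OF assms(1)])
  fix z :: nat assume "1 \<le> z" "z \<le> 8"
  then have "z < 40" "z \<notin> {9, 11, 12, 13, 14, 16}" by auto
  then show "regs s' z = regs s z" using assms(2) unfolding bits_frame_def by blast
qed (use assms(2) in \<open>simp add: bits_frame_def\<close>)

lemma ert_BITS:
  assumes s: "base s" "regs s 17 = 1"
    and S: "S1 \<subseteq> {..<2 * k * n}" "S0 \<subseteq> {..<2 * k * n}" "S1 \<inter> S0 = {}"
  shows "ert BITS s (bits_time X) (bits_frame s) (\<lambda>s'. of_bool (match S1 S0 (2 * k * n) s'))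
    (p ^ card S1 * (1 - p) ^ card S0)"
proof -
  define N where "N = 2 * k * n"
  \<comment> \<open>The probability that position \<open>l\<close> comes out as prescribed; a free
    position has weight 1.\<close>
  define w where "w l = (if l \<in> S1 then p else if l \<in> S0 then 1 - p else 1)" for l
  define f where "f i s' = of_bool (match S1 S0 i s') * (\<Prod>l\<in>{i..<N}. w l)" for i s'
  have "ert BITS s (N * ((bit_time X + 1 + 1) + 6) + 5) (\<lambda>s'. bits_frame s s' \<and> regs s' 17 = 1) (f N) (f 0 s)"
    unfolding BITS_def
  proof (rule ert_FOR[where Inv = "\<lambda>_. bits_frame s"])
    show "regs s 6 = N" using s unfolding base_def N_def by simp
    fix i s1 assume i: "i < N" and s1: "bits_frame s s1" "regs s1 9 = i" "regs s1 17 = 1"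
    \<comment> \<open>\<open>c\<close> is the value of the remaining positions; \<open>a\<close> and
      \<open>b\<close> are what drawing a one or a zero at position \<open>i\<close> is
      worth.\<close>
    define c where "c = (if match S1 S0 i s1 then \<Prod>l\<in>{Suc i..<N}. w l else 0)"
    define a where "a = (if i \<in> S0 then 0 else c)"
    define b where "b = (if i \<in> S1 then 0 else c)"
    show "ert (SEQ BIT (STORE 2 9 13)) s1 (bit_time X + 1 + 1)
      (\<lambda>s'. bits_frame s s' \<and> regs s' 9 = regs s1 9 \<and> regs s' 14 = regs s1 14 \<and> regs s' 17 = 1)
      (f (Suc i)) (f i s1)"
    proof (rule ert_SEQ)
      have "ert BIT s1 (bit_time X) (bit_frame s1) (\<lambda>s'. if regs s' 13 \<noteq> 0 then a else b) (a * p + b * (1 - p))"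
        using base_bits_frame[OF s(1) s1(1)] s1(3) by (rule ert_BIT)
      moreover have "f i s1 = a * p + b * (1 - p)"
      proof -
        have "(\<Prod>l\<in>{i..<N}. w l) = w i * (\<Prod>l\<in>{Suc i..<N}. w l)"
          using i by (simp add: prod.atLeast_Suc_lessThan)
        then show ?thesis using S(3) unfolding f_def a_def b_def c_def w_def by (auto simp: algebra_simps)
      qed
      ultimately show "ert BIT s1 (bit_time X) (bit_frame s1) (\<lambda>s'. if regs s' 13 \<noteq> 0 then a else b) (f i s1)" by simp
    next
      fix s2 assume s2: "bit_frame s1 s2"
      let ?s3 = "set_arr 2 (regs s2 9) (regs s2 13) s2"
      have "match S1 S0 (Suc i) ?s3 \<longleftrightarrow> match S1 S0 i s1 \<and> (i \<in> S1 \<longrightarrow> regs s2 13 \<noteq> 0) \<and> (i \<in> S0 \<longrightarrow> regs s2 13 = 0)"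
        using s2 s1(2) unfolding match_def bit_frame_def by (auto simp: less_Suc_eq)
      then have "(if regs s2 13 \<noteq> 0 then a else b) \<le> f (Suc i) ?s3"
        unfolding f_def a_def b_def c_def by auto
      then show "ert (STORE 2 9 13) s2 1
        (\<lambda>s'. bits_frame s s' \<and> regs s' 9 = regs s1 9 \<and> regs s' 14 = regs s1 14 \<and> regs s' 17 = 1)
        (f (Suc i)) (if regs s2 13 \<noteq> 0 then a else b)"
        using s1 s2 by (intro ert_exec[OF exec_STORE]) (auto simp: bit_frame_def bits_frame_def)
    qed
  qed (use s in \<open>auto simp: bits_frame_def f_def match_def\<close>)
  moreover have "f 0 s = p ^ card S1 * (1 - p) ^ card S0"
  proof -
    have "f 0 s = (\<Prod>l\<in>{..<N}. (if l \<in> S1 then p else 1) * (if l \<in> S0 then 1 - p else 1))"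
      unfolding f_def match_def w_def using S(3) by (auto simp: atLeast0LessThan intro!: prod.cong)
    also have "\<dots> = (\<Prod>l\<in>{..<N}. if l \<in> S1 then p else 1) * (\<Prod>l\<in>{..<N}. if l \<in> S0 then 1 - p else 1)"
      by (rule prod.distrib)
    also have "\<dots> = p ^ card S1 * (1 - p) ^ card S0"
      using S(1,2) unfolding N_def by (simp add: prod.If_cases Int_absorb1)
    finally show ?thesis .
  qed
  moreover have "f N = (\<lambda>s'. of_bool (match S1 S0 N s'))" unfolding f_def by auto
  moreover have "N * ((bit_time X + 1 + 1) + 6) + 5 \<le> bits_time X"
  proof -
    have "N \<le> 2 * X * X" unfolding N_def using X_ge(2,3) by (simp add: mult_le_mono)
    then have "N * (bit_time X + 8) \<le> 2 * X * X * (bit_time X + 8)" by (rule mult_le_mono1)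
    moreover have "bit_time X + 1 + 1 + 6 = bit_time X + 8" by simp
    ultimately show ?thesis unfolding bits_time_def by (metis add_le_mono1)
  qed
  ultimately show ?thesis unfolding N_def[symmetric] by (auto intro: ert_mono)
qed

text \<open>At most \<open>2 * k^2\<close> prescribed ones contribute \<open>p\<close> each, and all
  prescribed zeros together contribute at least \<open>1 / 2\<close>.\<close>

definition q :: real where "q = p ^ (2 * k\<^sup>2) / 2"

lemma p_bounds: "0 < p" "p \<le> 1"
  unfolding p_def by simp_all

lemma q_bounds: "0 \<le> q" "q \<le> 1"
proof -
  have "p ^ (2 * k\<^sup>2) \<le> 1" using p_bounds by (intro power_le_one) auto
  then show "0 \<le> q" "q \<le> 1" using p_bounds unfolding q_def by auto
qed

lemma trial_succeeds:
  assumes yes: "partial_grundy_yes G k" and s: "sound s" "regs s 0 = 0" "regs s 17 = 1"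
  obtains S1 S0 where "S1 \<subseteq> {..<2 * k * n}" "S0 \<subseteq> {..<2 * k * n}" "S1 \<inter> S0 = {}"
    "q \<le> p ^ card S1 * (1 - p) ^ card S0"
    "\<And>s'. bits_frame s s' \<Longrightarrow> match S1 S0 (2 * k * n) s' \<Longrightarrow> accepts G k (reps (arrs s')) (bits (arrs s'))"
proof -
  define R where "R = reps (arrs s)"
  have rdone: "reps_done n (arrs s)" and few: "few_exceptions R" using s unfolding sound_def R_def by auto
  have RV: "R \<subseteq> pverts G" unfolding R_def reps_def verts by auto
  obtain P1 P0 where P: "P1 \<subseteq> pverts G \<times> {..<2 * k}" "P0 \<subseteq> pverts G \<times> {..<2 * k}" "P1 \<inter> P0 = {}"
    "card P1 \<le> 2 * k\<^sup>2" "2 * card P0 \<le> 2 ^ (14 * k\<^sup>2)"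
    "\<And>D. P1 \<subseteq> D \<Longrightarrow> P0 \<inter> D = {} \<Longrightarrow> accepts G k R D"
  proof (rule accepting_pattern[OF yes k1 RV])
    show "\<exists>r\<in>R. v \<in> near G k r" if "v \<in> pverts G" for v
      using reps_done_covering[OF rdone that] unfolding R_def .
    show "card R \<le> 2 ^ k\<^sup>2" using few unfolding few_exceptions_def by blast
    show "card (nbs G r - common G k r) \<le> 4 * k ^ 6" if "r \<in> R" for r
      using few that unfolding few_exceptions_def by blast
  qed (rule that)
  \<comment> \<open>The position in array 2 of the bit for \<open>(v, c)\<close>.\<close>
  define h where "h = (\<lambda>(v, c). n * c + v)"
  have inj: "inj_on h (pverts G \<times> UNIV)"
  proof (rule inj_onI)
    fix x y assume xy: "x \<in> pverts G \<times> UNIV" "y \<in> pverts G \<times> UNIV" "h x = h y"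
    have "h x mod n = fst x \<and> h x div n = snd x" "h y mod n = fst y \<and> h y div n = snd y"
      using xy(1,2) unfolding h_def verts by auto
    then show "x = y" using xy(3) by (metis prod_eqI)
  qed
  have less: "h x < 2 * k * n" if x: "x \<in> pverts G \<times> {..<2 * k}" for x
  proof -
    obtain v c where x: "x = (v, c)" "v < n" "c < 2 * k" using x unfolding verts by auto
    then have "n * c + v < n * Suc c" by simp
    also have "\<dots> \<le> n * (2 * k)" using x(3) by (intro mult_le_mono2) simp
    finally show ?thesis unfolding h_def x by (simp add: mult.commute)
  qed
  have fin: "finite P1" "finite P0" using P(1,2) by (auto intro: finite_subset)
  show thesis
  proof (rule that[of "h ` P1" "h ` P0"])
    show "h ` P1 \<subseteq> {..<2 * k * n}" "h ` P0 \<subseteq> {..<2 * k * n}"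
      using less subsetD[OF P(1)] subsetD[OF P(2)] by (meson image_subsetI lessThan_iff)+
    show "h ` P1 \<inter> h ` P0 = {}"
      using inj_on_image_Int[OF inj, of P1 P0] P(1-3) by auto
    have c1: "card (h ` P1) \<le> 2 * k\<^sup>2" using card_image_le[OF fin(1), of h] P(4) by simp
    \<comment> \<open>The gap between the exponents 14 and 16 leaves room for Bernoulli's
      inequality, which bounds the probability of all prescribed zeros below.\<close>
    have c0: "real (card (h ` P0)) * p \<le> 1 / 2"
    proof -
      have "2 * card (h ` P0) \<le> 2 ^ (14 * k\<^sup>2)" using card_image_le[OF fin(2), of h] P(5) by simp
      also have "\<dots> \<le> 2 ^ (16 * k\<^sup>2)" by (rule power_increasing) auto
      finally have "2 * card (h ` P0) \<le> 2 ^ (16 * k\<^sup>2)" .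
      then have "real (2 * card (h ` P0)) \<le> real (2 ^ (16 * k\<^sup>2))" by (rule of_nat_mono)
      then show ?thesis unfolding p_def by (simp add: field_simps)
    qed
    have "p ^ (2 * k\<^sup>2) \<le> p ^ card (h ` P1)"
      using c1 p_bounds by (intro power_decreasing) auto
    moreover have "1 / 2 \<le> (1 - p) ^ card (h ` P0)"
      using Bernoulli_inequality[of "- p" "card (h ` P0)"] c0 p_bounds by simp
    ultimately show "q \<le> p ^ card (h ` P1) * (1 - p) ^ card (h ` P0)"
      using mult_mono[of "p ^ (2 * k\<^sup>2)" "p ^ card (h ` P1)" "1 / 2" "(1 - p) ^ card (h ` P0)"] p_bounds
      unfolding q_def by simp
    fix s' assume s': "bits_frame s s'" "match (h ` P1) (h ` P0) (2 * k * n) s'"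
    have "reps (arrs s') = R" using s'(1) unfolding R_def reps_def bits_frame_def by simp
    moreover have "P1 \<subseteq> bits (arrs s')"
    proof
      fix x assume x: "x \<in> P1"
      then have "arrs s' 2 (h x) \<noteq> 0" using s'(2) less[of x] P(1) unfolding match_def by blast
      then show "x \<in> bits (arrs s')" using x P(1) unfolding bits_def h_def verts by auto
    qed
    moreover have "P0 \<inter> bits (arrs s') = {}"
    proof -
      have "arrs s' 2 (h x) = 0" if "x \<in> P0" for x
        using s'(2) less[of x] P(2) that unfolding match_def by blast
      then show ?thesis unfolding bits_def h_def by fastforce
    qed
    ultimately show "accepts G k (reps (arrs s')) (bits (arrs s'))" using P(6) by simp
  qed
qed

text \<open>Here \<open>c\<close> is the success probability guaranteed by the later trials; the
  trial raises it to \<open>c + (1 - c) * q\<close> in a yes-instance.\<close>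

lemma ert_TRIAL:
  assumes s: "sound s" "regs s 17 = 1" and c: "0 \<le> c" "c \<le> 1"
    and f: "\<And>s'. f s' = (if regs s' 0 \<noteq> 0 then 1 else c)"
    and v: "v = (if regs s 0 \<noteq> 0 then 1 else if partial_grundy_yes G k then (1 - c) * q + c else c)"
  shows "ert TRIAL s (trial_time X)
    (\<lambda>s'. sound s' \<and> regs s' 10 = regs s 10 \<and> regs s' 15 = regs s 15 \<and> regs s' 17 = 1) f v"
proof -
  define N where "N = 2 * k * n"
  have base: "base s" using s unfolding sound_def by simp
  obtain S1 S0 where S: "S1 \<subseteq> {..<N}" "S0 \<subseteq> {..<N}" "S1 \<inter> S0 = {}"
    and hit: "\<And>s'. regs s 0 = 0 \<Longrightarrow> partial_grundy_yes G k \<Longrightarrow> bits_frame s s' \<Longrightarrow> match S1 S0 N s' \<Longrightarrow>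
      accepts G k (reps (arrs s')) (bits (arrs s'))"
    and prob: "regs s 0 = 0 \<Longrightarrow> partial_grundy_yes G k \<Longrightarrow> q \<le> p ^ card S1 * (1 - p) ^ card S0"
  \<comment> \<open>If no success is required of this trial, the empty pattern serves.\<close>
  proof (cases "regs s 0 = 0 \<and> partial_grundy_yes G k")
    case True
    then show thesis using trial_succeeds[OF _ s(1) _ s(2)] that unfolding N_def by metis
  next
    case False
    then show thesis using that[of "{}" "{}"] by auto
  qed
  \<comment> \<open>\<open>b\<close> is secured without this trial, and \<open>a\<close> is the gain
    if the prescribed bits come up.\<close>
  define a where "a = (if regs s 0 \<noteq> 0 then 0 else if partial_grundy_yes G k then 1 - c else 0)"
  define b where "b = (if regs s 0 \<noteq> 0 then 1 else c)"
  have a: "0 \<le> a" using c unfolding a_def by simp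
  have trial: "ert TRIAL s (bits_time X + (cost acceptsE X + 6) + 1)
    (\<lambda>s'. sound s' \<and> regs s' 10 = regs s 10 \<and> regs s' 15 = regs s 15 \<and> regs s' 17 = 1) f
    (a * (p ^ card S1 * (1 - p) ^ card S0) + b)"
    unfolding TRIAL_def
  proof (rule ert_SEQ[OF ert_affine[OF ert_BITS[OF base s(2) S[unfolded N_def]] a]])
    fix s1 assume fr: "bits_frame s s1"
    have base1: "base s1" using base fr by (rule base_bits_frame)
    then have env: "env (regs s1) (arrs s1)" unfolding base_def by simp
    have r26: "regs s1 y \<le> X" if "y \<in> bnds (Plus (Var 0) acceptsE)" for y
      using that bnds_exps(3) envD[OF env] X_ge by auto
    obtain s2 where s2: "exec (ASSIGN 0 (Plus (Var 0) acceptsE)) s1 (cost (Plus (Var 0) acceptsE) X + 2) s2"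
      "arrs s2 = arrs s1"
      "\<And>z. z < 40 \<Longrightarrow> regs s2 z = (if z = 0 then aval (Plus (Var 0) acceptsE) (regs s1) (arrs s1) else regs s1 z)"
      using exec_ASSIGN[of "Plus (Var 0) acceptsE" s1 X 0] r26 by auto
    have r0: "regs s2 0 \<noteq> 0 \<longleftrightarrow> regs s 0 \<noteq> 0 \<or> accepts G k (reps (arrs s1)) (bits (arrs s1))"
      using s2(3)[of 0] holds_acceptsE[OF env] fr unfolding holds_def bits_frame_def by auto
    have reps: "reps (arrs s2) = reps (arrs s)" "reps_done n (arrs s2) = reps_done n (arrs s)"
      using s2(2) fr unfolding bits_frame_def reps_def reps_done_def by auto
    have "base s2" using base1 s2(2,3) by (auto intro: base_cong)
    then have "sound s2" using s(1) r0 reps yes_if_accepts unfolding sound_def by auto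
    moreover have "a * of_bool (match S1 S0 (2 * k * n) s1) + b \<le> f s2"
      using hit[OF _ _ fr] r0 c unfolding f a_def b_def N_def by auto
    moreover have "regs s2 10 = regs s 10" "regs s2 15 = regs s 15" "regs s2 17 = 1"
      using s2(3) fr s(2) unfolding bits_frame_def by auto
    ultimately show "ert (ASSIGN 0 (Plus (Var 0) acceptsE)) s1 (cost acceptsE X + 6)
      (\<lambda>s'. sound s' \<and> regs s' 10 = regs s 10 \<and> regs s' 15 = regs s 15 \<and> regs s' 17 = 1) f
      (a * of_bool (match S1 S0 (2 * k * n) s1) + b)"
      using s2(1) by (intro ert_exec[of _ _ _ s2]) (auto simp: add.commute)
  qed
  have "v \<le> a * (p ^ card S1 * (1 - p) ^ card S0) + b"
    using prob c unfolding v a_def b_def by (auto intro!: mult_left_mono)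
  then show ?thesis by (intro ert_mono[OF trial]) (simp_all add: trial_time_def)
qed

text \<open>Since \<open>q = 1 / 2 ^ (32 * k ^ 4 + 1)\<close>, the number \<open>T\<close> of trials
  satisfies \<open>T * q \<ge> 2\<close>. From
  \<open>(1 - q) ^ T * (1 + T * q) \<le> (1 - q^2) ^ T \<le> 1\<close> the failure probability is at
  most \<open>1 / 3\<close>.\<close>

lemma trials_suffice: "2 / 3 \<le> 1 - (1 - q) ^ 2 ^ (64 * k ^ 4)"
proof -
  define T :: nat where "T = 2 ^ (64 * k ^ 4)"
  have q: "q = 1 / 2 ^ (32 * k ^ 4 + 1)"
  proof -
    have "(16 * k\<^sup>2) * (2 * k\<^sup>2) = 32 * k ^ 4" by (simp add: power2_eq_square power4_eq_xxxx)
    then show ?thesis unfolding q_def p_def by (simp add: power_divide power_mult[symmetric])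
  qed
  have "1 \<le> k ^ 4" using k1 by simp
  then have "(2::nat) ^ (32 * k ^ 4 + 2) \<le> T" unfolding T_def by (intro power_increasing) auto
  then have "real (2 ^ (32 * k ^ 4 + 2)) \<le> real T" by (rule of_nat_mono)
  then have qT: "2 \<le> real T * q" unfolding q by (simp add: field_simps)
  have "(1 - q) ^ T * (1 + real T * q) \<le> (1 - q) ^ T * (1 + q) ^ T"
    using Bernoulli_inequality[of q T] q_bounds by (intro mult_left_mono) auto
  also have "\<dots> = (1 - q\<^sup>2) ^ T" by (simp add: power_mult_distrib[symmetric] algebra_simps power2_eq_square)
  also have "\<dots> \<le> 1" using q_bounds by (intro power_le_one) (auto simp: power_le_one)
  finally have "(1 - q) ^ T * (1 + real T * q) \<le> 1" .
  moreover have "(1 - q) ^ T * 3 \<le> (1 - q) ^ T * (1 + real T * q)"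
    using qT q_bounds by (intro mult_left_mono) auto
  ultimately show ?thesis unfolding T_def by simp
qed

lemma ert_GRUNDY:
  "ert GRUNDY (graph_input G n k) (total_time X) (\<lambda>s. regs s 0 \<noteq> 0 \<longrightarrow> partial_grundy_yes G k)
     (\<lambda>s. of_bool (regs s 0 \<noteq> 0)) (if partial_grundy_yes G k then 2 / 3 else 0)"
proof -
  define T :: nat where "T = 2 ^ (64 * k ^ 4)"
  \<comment> \<open>The success probability guaranteed with \<open>T - i\<close> trials left; at
    \<open>i = T\<close> only the content of register 0 counts.\<close>
  define f where "f i s = (if regs s 0 \<noteq> 0 then 1 else if partial_grundy_yes G k then 1 - (1 - q) ^ (T - i) else 0)"
    for i and s :: ram_state
  define v :: real where "v = (if partial_grundy_yes G k then 2 / 3 else 0)"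
  have "ert GRUNDY (graph_input G n k)
     (init_time X + (reps_time X + ((cost yesE X + 2) + (T * (trial_time X + 6) + 5) + 1) + 1) + 1)
     (\<lambda>s. sound s \<and> regs s 17 = 1) (f T) v"
    unfolding GRUNDY_def
  proof (rule ert_SEQ[OF ert_INIT], rule ert_SEQ[OF ert_REPS])
    fix s assume "(base s \<and> reps_done n (arrs s)) \<and> regs s 17 = 1"
    then show "ert (SEQ (ASSIGN 0 yesE) (FOR 17 10 7 15 TRIAL)) s
        ((cost yesE X + 2) + (T * (trial_time X + 6) + 5) + 1) (\<lambda>s. sound s \<and> regs s 17 = 1) (f T) v"
    proof (intro ert_SEQ[OF ert_yesE])
      fix s assume s: "sound s \<and> regs s 17 = 1"
      have "ert (FOR 17 10 7 15 TRIAL) s (T * (trial_time X + 6) + 5) (\<lambda>s. sound s \<and> regs s 17 = 1) (f T) (f 0 s)"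
      proof (rule ert_FOR[where Inv = "\<lambda>_. sound"])
        show "regs s 7 = T" using s unfolding sound_def base_def T_def by simp
        fix i s assume i: "i < T" and s: "sound s" "regs s 10 = i" "regs s 17 = 1"
        define c where "c = (if partial_grundy_yes G k then 1 - (1 - q) ^ (T - Suc i) else 0)"
        have "(1 - q) ^ (T - Suc i) \<le> 1" using q_bounds by (intro power_le_one) auto
        then have c: "0 \<le> c" "c \<le> 1" using q_bounds unfolding c_def by auto
        have d: "T - i = Suc (T - Suc i)" using i by simp
        show "ert TRIAL s (trial_time X)
          (\<lambda>s'. sound s' \<and> regs s' 10 = regs s 10 \<and> regs s' 15 = regs s 15 \<and> regs s' 17 = 1) (f (Suc i)) (f i s)"
          by (rule ert_TRIAL[OF s(1,3) c]) (auto simp: f_def c_def d algebra_simps)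
      qed (use s in \<open>auto simp: sound_def f_def\<close>)
      moreover have "v \<le> f 0 s"
        using trials_suffice unfolding v_def f_def T_def by auto
      ultimately show "ert (FOR 17 10 7 15 TRIAL) s (T * (trial_time X + 6) + 5)
          (\<lambda>s. sound s \<and> regs s 17 = 1) (f T) v"
        by (auto intro: ert_mono)
    qed auto
  qed auto
  moreover have "T * (trial_time X + 6) \<le> X ^ 64 * (trial_time X + 6)"
    using X_ge(6) unfolding T_def by (rule mult_le_mono1)
  ultimately show ?thesis
    unfolding v_def by (elim ert_mono) (auto simp: total_time_def sound_def f_def)
qed

lemma answer_GRUNDY:
  assumes "total_time X \<le> t"
  shows "halts_within t GRUNDY (graph_input G n k)"
    and "\<not> partial_grundy_yes G k \<Longrightarrow> pmf (answer t GRUNDY (graph_input G n k)) (Some False) = 1"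
    and "partial_grundy_yes G k \<Longrightarrow> 2 / 3 \<le> pmf (answer t GRUNDY (graph_input G n k)) (Some True)"
proof -
  obtain M where M: "runs GRUNDY (graph_input G n k) (total_time X) M"
    "\<And>s. s \<in> set_pmf M \<Longrightarrow> regs s 0 \<noteq> 0 \<Longrightarrow> partial_grundy_yes G k"
    "(if partial_grundy_yes G k then 2 / 3 else 0 :: real) \<le> measure_pmf.expectation M (\<lambda>s. of_bool (regs s 0 \<noteq> 0))"
    using ert_GRUNDY unfolding ert_def by blast
  have "run t GRUNDY (graph_input G n k) = map_pmf (Pair SKIP) M"
    using runs_mono[OF M(1) assms] unfolding runs_def .
  then have ans: "answer t GRUNDY (graph_input G n k) = map_pmf (\<lambda>s. Some (regs s 0 \<noteq> 0)) M"
    unfolding answer_def by (simp add: pmf.map_comp o_def)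
  show "halts_within t GRUNDY (graph_input G n k)" unfolding halts_within_def ans by auto
  show "pmf (answer t GRUNDY (graph_input G n k)) (Some False) = 1" if "\<not> partial_grundy_yes G k"
  proof -
    have "answer t GRUNDY (graph_input G n k) = map_pmf (\<lambda>_. Some False) M"
      unfolding ans using M(2) that by (intro map_pmf_cong) auto
    then show ?thesis by (simp add: map_pmf_const)
  qed
  show "2 / 3 \<le> pmf (answer t GRUNDY (graph_input G n k)) (Some True)" if "partial_grundy_yes G k"
  proof -
    have "pmf (answer t GRUNDY (graph_input G n k)) (Some True) = measure_pmf.prob M {s. regs s 0 \<noteq> 0}"
      unfolding ans pmf_map by (intro arg_cong[where f = "measure_pmf.prob M"]) auto
    also have "\<dots> = measure_pmf.expectation M (indicator {s. regs s 0 \<noteq> 0})" by simp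
    also have "indicator {s. regs s 0 \<noteq> 0} = (\<lambda>s. of_bool (regs s 0 \<noteq> 0) :: real)"
      by (auto simp: indicator_def)
    finally show ?thesis using M(3) that by simp
  qed
qed

end

theorem theorem14:
  shows "\<exists>(p :: com) (a :: nat) (b :: nat). \<forall>(G :: nat pair_pre_digraph) (n :: nat) (k :: nat).
    pair_graph G \<longrightarrow> pverts G = {..<n} \<longrightarrow> k \<ge> 1 \<longrightarrow>
    (let t = 2 ^ (a * k ^ 4) * (max 1 n) ^ b; s = graph_input G n k in
       halts_within t p s \<and>
       (\<not> partial_grundy_yes G k \<longrightarrow> pmf (answer t p s) (Some False) = 1) \<and>
       (partial_grundy_yes G k \<longrightarrow> pmf (answer t p s) (Some True) \<ge> 2 / 3))"
proof -
  obtain c where c: "\<forall>B\<ge>2. total_time B \<le> B ^ c"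
    using poly_bounded_total_time unfolding poly_bounded_def ..
  show ?thesis
  proof (intro exI[of _ GRUNDY] exI[of _ c] allI impI)
    fix G :: "nat pair_pre_digraph" and n k :: nat
    assume "pair_graph G" "pverts G = {..<n}" "k \<ge> 1"
    then interpret grundy_instance G n k
      by (simp add: grundy_instance_def grundy_instance_axioms_def)
    \<comment> \<open>The exponent \<open>c\<close> serves for both \<open>a\<close> and
      \<open>b\<close>.\<close>
    have "X ^ c = 2 ^ (c * k ^ 4) * (max 1 n) ^ c"
      unfolding X_def by (simp add: power_mult_distrib power_mult[symmetric] mult.commute)
    then have "total_time X \<le> 2 ^ (c * k ^ 4) * (max 1 n) ^ c" using c X_ge(1) by metis
    from answer_GRUNDY[OF this]
    show "let t = 2 ^ (c * k ^ 4) * (max 1 n) ^ c; s = graph_input G n k in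
       halts_within t GRUNDY s \<and>
       (\<not> partial_grundy_yes G k \<longrightarrow> pmf (answer t GRUNDY s) (Some False) = 1) \<and>
       (partial_grundy_yes G k \<longrightarrow> pmf (answer t GRUNDY s) (Some True) \<ge> 2 / 3)"
      unfolding Let_def by blast
  qed
qed

end
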